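(* There exists a real number $\gamma$ with $0<\gamma<\frac{1}{2}$ such that $g(n)\le g_1(n)<n^{\gamma}$ for all sufficiently large integers $n$.
   Context: For integers $n>1$ and $k\ge 1$, say that $(n,k)$ has a prime representation if there are distinct primes $P_1,\dots,P_k$ with $P_j\mid (n+j)$ for $1\le j\le k$; $g(n)$ is the largest positive integer $k$ such that $(n,k)$ has a prime representation. For an integer $\nu>1$, $\omega(\nu)$ is the number of distinct prime divisors of $\nu$, and $\omega(1)=0$. $g_1(n)$ is the largest positive integer $k$ such that $\omega\big(\prod_{i=1}^{l}(n+i)\big)\ge l$ for all $1\le l\le k$. *)

theory Defs
  imports Complex_Main "HOL-Computational_Algebra.Primes"
begin

definition has_prime_rep :: "nat \<Rightarrow> nat \<Rightarrow> bool" where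
  "has_prime_rep n k \<longleftrightarrow>
     (\<exists>P :: nat \<Rightarrow> nat. inj_on P {1..k} \<and>
        (\<forall>j\<in>{1..k}. prime (P j) \<and> P j dvd (n + j)))"

definition g :: "nat \<Rightarrow> nat" where
  "g n = (GREATEST k. k \<ge> 1 \<and> has_prime_rep n k)"

definition omega :: "nat \<Rightarrow> nat" where
  "omega m = card (prime_factors m)"

definition g1 :: "nat \<Rightarrow> nat" where
  "g1 n = (GREATEST k. k \<ge> 1 \<and>
             (\<forall>l\<in>{1..k}. omega (\<Prod>i=1..l. n + i) \<ge> l))"

end

theory Submission
  imports Defs "HOL-Computational_Algebra.Squarefree" "HOL-Number_Theory.Totient"
    "HOL-Analysis.Kronecker_Approximation_Theorem" "HOL-Real_Asymp.Real_Asymp"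
begin

text \<open>
  Let \<open>\<gamma> = 1/2 - \<epsilon>\<close> and \<open>k = \<lceil>n powr \<gamma>\<rceil>\<close>, and suppose that \<open>M = (n+1)\<dots>(n+k)\<close> has at least \<open>k\<close> distinct
  prime factors. Only \<open>o(k)\<close> of them are at most \<open>k\<close>, and the product of the others times \<open>k!\<close>
  divides \<open>M\<close>, so their logarithms add up to at most about \<open>k (ln n - ln k) = (1/2 + \<epsilon>) k ln n\<close>.
  If only a proportion \<open>\<tau>\<close> of them lay in the window between \<open>k\<close> and \<open>n powr (1/2 + \<delta>)\<close>, the sum
  would be at least about \<open>(1/2 + \<delta> - \<tau> (\<delta> + \<epsilon>)) k ln n\<close>, which is larger as soon as
  \<open>\<epsilon> < \<delta> - \<tau> (\<delta> + \<epsilon>)\<close>.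

  Selberg's upper bound sieve of level \<open>n powr \<rho>\<close> gives \<open>\<tau> = O((\<delta> + \<epsilon>) / \<rho>)\<close>, so small \<open>\<delta>\<close> and
  \<open>\<epsilon>\<close> work. The sieve needs the number of pairs \<open>(m, i)\<close> with \<open>e dvd m\<close>, \<open>m dvd n + i\<close> and \<open>m\<close> in
  the window, with a power saving in the error. This reduces to sums of the sawtooth function at
  \<open>y / j\<close> with \<open>j\<close> near \<open>sqrt y\<close>: on short blocks \<open>y / j\<close> is close to an arithmetic progression with
  rational slope \<open>a / q\<close>, which is equidistributed modulo 1 unless \<open>q\<close> is small, and the slopes
  near a fraction with small denominator are rare.

  The values used are \<open>\<epsilon> = 1/12800\<close>, \<open>\<delta> = 1/1600\<close>, \<open>\<rho> = 1/200\<close> and \<open>\<tau> = 3/10\<close>, so that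
  \<open>\<gamma> = 6399/12800\<close> and \<open>1/2 + \<delta> = 801/1600\<close>.
\<close>

section \<open>Elementary estimates\<close>

lemma nat_floor_bounds:
  fixes x :: real
  assumes "x \<ge> 1"
  shows "1 \<le> nat \<lfloor>x\<rfloor>" "real (nat \<lfloor>x\<rfloor>) \<le> x" "x / 2 \<le> real (nat \<lfloor>x\<rfloor>)" "x \<le> real (nat \<lfloor>x\<rfloor>) + 1"
proof -
  have f: "1 \<le> \<lfloor>x\<rfloor>" using assms by simp
  then have "real (nat \<lfloor>x\<rfloor>) = of_int \<lfloor>x\<rfloor>" by simp
  with f show "1 \<le> nat \<lfloor>x\<rfloor>" "real (nat \<lfloor>x\<rfloor>) \<le> x" "x / 2 \<le> real (nat \<lfloor>x\<rfloor>)" "x \<le> real (nat \<lfloor>x\<rfloor>) + 1"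
    by linarith+
qed

lemma ln_add1_diff_le:
  fixes x :: real
  assumes "x > 0"
  shows "ln (x + 1) - ln x \<le> 1 / x"
proof -
  have "ln ((x + 1) / x) \<le> (x + 1) / x - 1" using assms by (intro ln_le_minus_one) auto
  moreover have "(x + 1) / x - 1 = 1 / x" using assms by (simp add: field_simps)
  ultimately show ?thesis using assms by (simp add: ln_div)
qed

lemma sum_inverse_bounds:
  assumes "0 < A" "A \<le> B"
  shows "ln (real B) - ln (real A) \<le> (\<Sum>j=A..<B. 1 / real j)"
    and "2 \<le> A \<Longrightarrow> (\<Sum>j=A..<B. 1 / real j) \<le> ln (real B - 1) - ln (real A - 1)"
  using assms(2)
proof (induction B rule: dec_induct)
  case (step B)
  have B: "real B > 0" using step assms by simp
  {
    case 1
    show ?case using step ln_add1_diff_le[OF B] by (simp add: add.commute)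
  next
    case 2
    then have "real B - 1 > 0" using step by simp
    then have "ln ((real B - 1) / real B) \<le> (real B - 1) / real B - 1"
      using B by (intro ln_le_minus_one) simp
    moreover have "ln ((real B - 1) / real B) = ln (real B - 1) - ln (real B)"
      using B \<open>real B - 1 > 0\<close> by (simp add: ln_div)
    moreover have "(real B - 1) / real B - 1 = - (1 / real B)" using B by (simp add: field_simps)
    ultimately show ?case using step 2 by simp
  }
qed auto

text \<open>Real endpoints are allowed because the sum will run over a window divided by a sieve
  modulus. Rounding each endpoint shifts the logarithm by \<open>O(1 / a)\<close>.\<close>

lemma abs_sum_inverse_diff_ln_le:
  fixes a b :: real
  assumes "2 \<le> a" "a \<le> b"
  shows "\<bar>(\<Sum>j=nat \<lfloor>a\<rfloor> + 1..<nat \<lfloor>b\<rfloor> + 1. 1 / real j) - ln (b / a)\<bar> \<le> 2 / a"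
proof -
  let ?A = "nat \<lfloor>a\<rfloor> + 1" and ?B = "nat \<lfloor>b\<rfloor> + 1"
  have AB: "real ?A \<le> a + 1" "a \<le> real ?A" "real ?B \<le> b + 1" "b \<le> real ?B" "2 \<le> ?A" "?A \<le> ?B"
    using assms by (auto simp: le_nat_iff le_floor_iff nat_mono floor_mono) linarith+
  have "ln (a + 1) - ln a \<le> 1 / a" using assms by (intro ln_add1_diff_le) auto
  moreover have "ln (real ?A) \<le> ln (a + 1)" "ln b \<le> ln (real ?B)" using AB assms by simp_all
  moreover have "ln (a / (a - 1)) \<le> a / (a - 1) - 1" using assms by (intro ln_le_minus_one) auto
  moreover have "a / (a - 1) - 1 \<le> 2 / a" using assms by (simp add: field_simps)
  moreover have "ln (a / (a - 1)) = ln a - ln (a - 1)" using assms by (simp add: ln_div)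
  moreover have "ln (a - 1) \<le> ln (real ?A - 1)" "ln (real ?B - 1) \<le> ln b"
    using AB assms by simp_all
  moreover have "ln (b / a) = ln b - ln a" using assms by (simp add: ln_div)
  moreover have "1 / a \<le> 2 / a" using assms by (simp add: divide_simps)
  moreover have "ln (real ?B) - ln (real ?A) \<le> (\<Sum>j=?A..<?B. 1 / real j)"
    "(\<Sum>j=?A..<?B. 1 / real j) \<le> ln (real ?B - 1) - ln (real ?A - 1)"
    using AB(5,6) by (intro sum_inverse_bounds; simp)+
  ultimately show ?thesis by linarith
qed

lemma ln_fact_ge: "ln (fact k) \<ge> real k * ln (real k) - real k"
proof (induction k)
  case (Suc k)
  have *: "real k * (ln (real (Suc k)) - ln (real k)) \<le> 1"
  proof (cases "k = 0")
    case False
    then have "ln (real (Suc k)) - ln (real k) \<le> 1 / real k"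
      using ln_add1_diff_le[of "real k"] by (simp add: add.commute)
    then show ?thesis using False by (simp add: field_simps)
  qed auto
  have "ln (fact (Suc k) :: real) = ln (real (Suc k)) + ln (fact k)"
    by (simp add: ln_mult)
  with * Suc show ?case by (simp add: algebra_simps)
qed auto

lemma fact_dvd_prod_consecutive: "fact k dvd (\<Prod>i=1..k. n + i :: nat)"
proof -
  have "fact (n + k) = fact n * (\<Prod>i=1..k. n + i)"
    by (induction k) (auto simp: algebra_simps)
  moreover have "fact n * fact k dvd (fact (n + k) :: nat)" by (rule fact_fact_dvd_fact)
  ultimately show ?thesis by simp
qed

lemma prod_primes_dvd:
  fixes M :: nat
  assumes "finite A" "\<And>p. p \<in> A \<Longrightarrow> prime p" "\<And>p. p \<in> A \<Longrightarrow> p dvd M"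
  shows "\<Prod>A dvd M"
  using assms
proof (induction A rule: finite_induct)
  case (insert p A)
  have "coprime p (\<Prod>A)"
    using insert.hyps insert.prems(1) by (intro prod_coprime_right) (auto intro!: primes_coprime)
  then show ?case using insert by (simp add: divides_mult)
qed simp

section \<open>The Selberg sieve\<close>

text \<open>On squarefree arguments this is the Moebius function. It never vanishes elsewhere, so
  its square is always 1; the sieve evaluates it at squarefree numbers only.\<close>

definition parity_sign :: "nat \<Rightarrow> real" where
  "parity_sign e = (-1) ^ card (prime_factors e)"

definition squarefrees_upto :: "nat \<Rightarrow> nat set" where
  "squarefrees_upto R = {l \<in> {1..R}. squarefree l}"

text \<open>The optimal Selberg normaliser has terms \<open>1 / totient l\<close>. The terms
  \<open>1 / l\<close> cost only a constant factor and make the lower bound elementary.\<close>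

definition squarefree_harm :: "nat \<Rightarrow> real" where
  "squarefree_harm R = (\<Sum>l\<in>squarefrees_upto R. 1 / real l)"

lemma finite_squarefrees_upto [simp]: "finite (squarefrees_upto R)"
  by (simp add: squarefrees_upto_def)

lemma squarefrees_upto_dvd:
  assumes "r \<in> squarefrees_upto R" "e dvd r"
  shows "e \<in> squarefrees_upto R"
  using assms unfolding squarefrees_upto_def
  by (auto intro: squarefree_mono dest: dvd_imp_le)

lemma squarefree_harm_pos: "R \<ge> 1 \<Longrightarrow> squarefree_harm R > 0"
  unfolding squarefree_harm_def
proof (intro sum_pos)
  assume "R \<ge> 1"
  then have "1 \<in> squarefrees_upto R" by (simp add: squarefrees_upto_def)
  then show "squarefrees_upto R \<noteq> {}" by blast
qed (auto simp: squarefrees_upto_def)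

lemma parity_sign_prime_mult:
  assumes "prime p" "\<not> p dvd e" "e > 0"
  shows "parity_sign (p * e) = - parity_sign e"
proof -
  have "prime_factors (p * e) = insert p (prime_factors e)"
    using assms by (auto simp: prime_factors_product prime_prime_factors)
  moreover have "p \<notin> prime_factors e"
    using assms by (auto simp: prime_factors_dvd)
  ultimately show ?thesis by (simp add: parity_sign_def)
qed

lemma parity_sign_square [simp]: "parity_sign e ^ 2 = 1" "\<bar>parity_sign e\<bar> = 1"
  unfolding parity_sign_def by (simp_all add: power_abs flip: power_mult)

text \<open>Multiplication by a prime \<open>p\<close> with \<open>p dvd r\<close> and \<open>\<not> p dvd l\<close> is a sign-reversing
  pairing of the intermediate divisors.\<close>
lemma sum_parity_sign_interval:
  fixes l r :: nat
  assumes "squarefree r" "l dvd r"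
  shows "(\<Sum>e | l dvd e \<and> e dvd r. parity_sign e) = (if l = r then parity_sign l else 0)"
proof (cases "l = r")
  case True
  then have "{e. l dvd e \<and> e dvd r} = {l}" by (auto intro: dvd_antisym)
  with True show ?thesis by simp
next
  case False
  have r0: "r > 0" using assms(1) by (auto intro!: Nat.gr0I)
  obtain q where q: "r = l * q" using assms(2) by blast
  with False have "q \<noteq> 1" by auto
  then obtain p where p: "prime p" "p dvd q" using prime_factor_nat by blast
  have pl: "\<not> p dvd l"
  proof
    assume "p dvd l"
    with p q have "p^2 dvd r" by (simp add: power2_eq_square mult_dvd_mono)
    with assms(1) p(1) show False by (auto simp: squarefree_def)
  qed
  let ?D = "{e. l dvd e \<and> e dvd r}"
  let ?Dn = "{e\<in>?D. \<not> p dvd e}" and ?Dp = "{e\<in>?D. p dvd e}"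
  have fin: "finite ?D" using r0 by (auto intro: finite_subset[OF _ finite_divisors_nat[of r]])
  have "bij_betw ((*) p) ?Dn ?Dp"
  proof (rule bij_betwI[where g="\<lambda>e. e div p"])
    show "(*) p \<in> ?Dn \<rightarrow> ?Dp"
    proof (rule funcsetI)
      fix e assume "e \<in> ?Dn"
      then have e: "l dvd e" "e dvd r" "\<not> p dvd e" by auto
      have "p dvd r" using p q by simp
      moreover have "coprime p e" using p e by (simp add: prime_imp_coprime)
      ultimately have "p * e dvd r" using e(2) by (simp add: divides_mult)
      then show "p * e \<in> ?Dp" using e by auto
    qed
    show "(\<lambda>e. e div p) \<in> ?Dp \<rightarrow> ?Dn"
    proof (rule funcsetI)
      fix e assume "e \<in> ?Dp"
      then obtain m where em: "e = p * m" and e: "l dvd p * m" "p * m dvd r" by auto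
      have "coprime l p" using p pl by (metis coprime_commute prime_imp_coprime)
      then have "l dvd m" using e by (simp add: coprime_dvd_mult_right_iff)
      moreover have "m dvd r" using e(2) dvd_mult_right by blast
      moreover have "\<not> p dvd m"
      proof
        assume "p dvd m"
        then have "p^2 dvd r" using e(2)
          by (metis dvd_trans mult_dvd_mono dvd_refl power2_eq_square)
        with assms(1) p(1) show False by (auto simp: squarefree_def)
      qed
      moreover have "p * m div p = m" using p(1) by (simp add: prime_gt_0_nat)
      ultimately show "e div p \<in> ?Dn" unfolding em by simp
    qed
  qed (use p(1) in \<open>auto simp: prime_gt_0_nat\<close>)
  then have "(\<Sum>e\<in>?Dp. parity_sign e) = (\<Sum>e\<in>?Dn. parity_sign (p * e))"
    by (rule sum.reindex_bij_betw[symmetric])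
  also have "\<dots> = (\<Sum>e\<in>?Dn. - parity_sign e)"
  proof (intro sum.cong refl parity_sign_prime_mult)
    fix e assume "e \<in> ?Dn"
    then show "prime p" "\<not> p dvd e" "0 < e" using p r0 by (auto intro!: Nat.gr0I)
  qed
  finally have "(\<Sum>e\<in>?Dp. parity_sign e) + (\<Sum>e\<in>?Dn. parity_sign e) = 0"
    by (simp add: sum_negf)
  moreover have "(\<Sum>e\<in>?D. parity_sign e) = (\<Sum>e\<in>?Dp. parity_sign e) + (\<Sum>e\<in>?Dn. parity_sign e)"
  proof -
    have "?D = ?Dp \<union> ?Dn" by auto
    then have "(\<Sum>e\<in>?D. parity_sign e) = (\<Sum>e\<in>?Dp \<union> ?Dn. parity_sign e)"
      by (rule arg_cong[where f = "sum parity_sign"])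
    also have "\<dots> = (\<Sum>e\<in>?Dp. parity_sign e) + (\<Sum>e\<in>?Dn. parity_sign e)"
      by (rule sum.union_disjoint) (use fin in \<open>auto intro: finite_subset[OF _ fin]\<close>)
    finally show ?thesis .
  qed
  ultimately show ?thesis using False by simp
qed

text \<open>This is Moebius inversion over multiples: it solves for the weights whose diagonal
  coordinates are \<open>parity_sign l / (l * squarefree_harm R)\<close>.\<close>

definition selberg_weight :: "nat \<Rightarrow> nat \<Rightarrow> real" where
  "selberg_weight R e = real e * parity_sign e / squarefree_harm R *
     (\<Sum>r | r \<in> squarefrees_upto R \<and> e dvd r. 1 / real r)"

lemma selberg_weight_1: "R \<ge> 1 \<Longrightarrow> selberg_weight R 1 = 1"
  using squarefree_harm_pos[of R] by (simp add: selberg_weight_def parity_sign_def squarefree_harm_def)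

text \<open>Division by \<open>e\<close> maps the multiples of \<open>e\<close> among the squarefree
  numbers injectively into the squarefree numbers, so \<open>e\<close> times the inner sum is at
  most the normaliser.\<close>

lemma abs_selberg_weight_le:
  assumes "R \<ge> 1" "e \<ge> 1"
  shows "\<bar>selberg_weight R e\<bar> \<le> 1"
proof -
  let ?A = "{r. r \<in> squarefrees_upto R \<and> e dvd r}"
  have S: "squarefree_harm R > 0" using assms squarefree_harm_pos by blast
  have inj: "inj_on (\<lambda>r. r div e) ?A"
    using assms by (auto intro!: inj_onI simp: dvd_div_eq_iff)
  have "real e * (\<Sum>r\<in>?A. 1 / real r) = (\<Sum>r\<in>?A. 1 / real (r div e))"
    unfolding sum_distrib_left using assms by (intro sum.cong) (auto simp: real_of_nat_div)
  also have "\<dots> = (\<Sum>s\<in>(\<lambda>r. r div e) ` ?A. 1 / real s)"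
    using inj by (simp add: sum.reindex)
  also have "\<dots> \<le> squarefree_harm R"
    unfolding squarefree_harm_def
  proof (intro sum_mono2)
    show "(\<lambda>r. r div e) ` ?A \<subseteq> squarefrees_upto R"
      by (auto intro: squarefrees_upto_dvd dvd_div_eq_mult)
        (metis dvd_triv_right dvd_mult_div_cancel squarefrees_upto_dvd)
  qed auto
  finally have "real e * (\<Sum>r\<in>?A. 1 / real r) \<le> squarefree_harm R" .
  moreover have "(\<Sum>r\<in>?A. 1 / real r) \<ge> 0" by (intro sum_nonneg) auto
  ultimately show ?thesis using S
    by (simp add: selberg_weight_def abs_mult)
qed

text \<open>The weights are chosen so that the diagonalised form has the explicit coordinates below.\<close>
lemma sum_selberg_weight_multiples:
  assumes "R \<ge> 1" "l \<ge> 1"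
  shows "(\<Sum>e | e \<in> squarefrees_upto R \<and> l dvd e. selberg_weight R e / real e)
    = (if l \<in> squarefrees_upto R then parity_sign l / (real l * squarefree_harm R) else 0)"
proof -
  let ?Q = "squarefrees_upto R" and ?S = "squarefree_harm R"
  have S: "?S > 0" using assms squarefree_harm_pos by blast
  have "(\<Sum>e | e \<in> ?Q \<and> l dvd e. selberg_weight R e / real e)
      = (\<Sum>e | e \<in> ?Q \<and> l dvd e. \<Sum>r | r \<in> ?Q \<and> e dvd r. parity_sign e / real r / ?S)"
  proof (intro sum.cong refl)
    fix e assume "e \<in> {e. e \<in> ?Q \<and> l dvd e}"
    then have "real e \<noteq> 0" by (auto simp: squarefrees_upto_def)
    then have "selberg_weight R e / real e
        = parity_sign e / ?S * (\<Sum>r | r \<in> ?Q \<and> e dvd r. 1 / real r)"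
      by (simp add: selberg_weight_def)
    also have "\<dots> = (\<Sum>r | r \<in> ?Q \<and> e dvd r. parity_sign e / real r / ?S)"
      unfolding sum_distrib_left by (intro sum.cong refl) simp
    finally show "selberg_weight R e / real e = \<dots>" .
  qed
  also have "\<dots> = (\<Sum>r\<in>?Q. \<Sum>e | e \<in> {e\<in>?Q. l dvd e} \<and> e dvd r. parity_sign e / real r / ?S)"
    by (rule sum.swap_restrict) auto
  also have "\<dots> = (\<Sum>r\<in>?Q. if l = r then parity_sign l / (real l * ?S) else 0)"
  proof (intro sum.cong refl)
    fix r assume r: "r \<in> ?Q"
    have eq: "{e. e \<in> {e\<in>?Q. l dvd e} \<and> e dvd r} = {e. l dvd e \<and> e dvd r}"
      using r squarefrees_upto_dvd by auto
    have "(\<Sum>e | l dvd e \<and> e dvd r. parity_sign e) = (if l = r then parity_sign l else 0)"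
    proof (cases "l dvd r")
      case True
      then show ?thesis using r by (intro sum_parity_sign_interval) (auto simp: squarefrees_upto_def)
    next
      case False
      then have none: "{e. l dvd e \<and> e dvd r} = {}" using dvd_trans by blast
      have "l \<noteq> r" using False by auto
      then show ?thesis unfolding none by simp
    qed
    then show "(\<Sum>e | e \<in> {e\<in>?Q. l dvd e} \<and> e dvd r. parity_sign e / real r / ?S)
        = (if l = r then parity_sign l / (real l * ?S) else 0)"
      unfolding eq by (simp add: sum_divide_distrib[symmetric])
  qed
  also have "\<dots> = (if l \<in> ?Q then parity_sign l / (real l * ?S) else 0)"
    by (subst sum.delta') auto
  finally show ?thesis .
qed

text \<open>Since \<open>1 / lcm e f = gcd e f / (e * f)\<close> and \<open>gcd e f\<close> is the
  sum of \<open>totient l\<close> over its divisors \<open>l\<close>, the form is a sum of squares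
  weighted by \<open>totient l\<close>, whose coordinates are known explicitly.\<close>

lemma selberg_quadratic_form_le:
  assumes "R \<ge> 1"
  shows "(\<Sum>e\<in>squarefrees_upto R. \<Sum>f\<in>squarefrees_upto R.
      selberg_weight R e * selberg_weight R f / real (lcm e f)) \<le> 1 / squarefree_harm R"
proof -
  let ?Q = "squarefrees_upto R" and ?S = "squarefree_harm R" and ?w = "selberg_weight R"
  have S: "?S > 0" using assms squarefree_harm_pos by blast
  have "(\<Sum>e\<in>?Q. \<Sum>f\<in>?Q. ?w e * ?w f / real (lcm e f))
     = (\<Sum>e\<in>?Q. \<Sum>f\<in>?Q. \<Sum>l=1..R. real (totient l) * ((if l dvd e then ?w e / real e else 0)
         * (if l dvd f then ?w f / real f else 0)))"
  proof (intro sum.cong refl)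
    fix e f assume ef: "e \<in> ?Q" "f \<in> ?Q"
    then have pos: "e > 0" "f > 0" "e \<le> R" by (auto simp: squarefrees_upto_def)
    have "{l\<in>{1..R}. l dvd e \<and> l dvd f} = {l. l dvd gcd e f}"
    proof safe
      fix l assume "l dvd gcd e f"
      then have "l dvd e" "l dvd f" by auto
      then show "l dvd e" "l dvd f" .
      have "l \<le> e" "l \<noteq> 0" using \<open>l dvd e\<close> pos by (auto dest: dvd_imp_le)
      then show "l \<in> {1..R}" using pos by simp
    qed simp
    then have "(\<Sum>l | l \<in> {1..R} \<and> l dvd e \<and> l dvd f. totient l) = gcd e f"
      using totient_divisor_sum[of "gcd e f"] by simp
    then have g: "real (gcd e f) = (\<Sum>l | l \<in> {1..R} \<and> l dvd e \<and> l dvd f. real (totient l))"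
      by (metis of_nat_sum)
    have "real (gcd e f) * real (lcm e f) = real e * real f"
      by (metis of_nat_mult prod_gcd_lcm_nat)
    then have "?w e * ?w f / real (lcm e f) = real (gcd e f) * (?w e / real e * (?w f / real f))"
      using pos by (simp add: field_simps)
    also have "\<dots> = (\<Sum>l=1..R. if l dvd e \<and> l dvd f then real (totient l) * (?w e / real e * (?w f / real f)) else 0)"
      unfolding g sum_distrib_right by (subst sum.inter_filter[symmetric]) auto
    also have "\<dots> = (\<Sum>l=1..R. real (totient l) * ((if l dvd e then ?w e / real e else 0)
         * (if l dvd f then ?w f / real f else 0)))"
      by (intro sum.cong) auto
    finally show "?w e * ?w f / real (lcm e f) = \<dots>" .
  qed
  also have "\<dots> = (\<Sum>l=1..R. \<Sum>e\<in>?Q. \<Sum>f\<in>?Q. real (totient l) *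
      ((if l dvd e then ?w e / real e else 0) * (if l dvd f then ?w f / real f else 0)))"
    (is "(\<Sum>e\<in>?Q. \<Sum>f\<in>?Q. \<Sum>l=1..R. ?F e f l) = _")
  proof -
    have "(\<Sum>e\<in>?Q. \<Sum>f\<in>?Q. \<Sum>l=1..R. ?F e f l) = (\<Sum>e\<in>?Q. \<Sum>l=1..R. \<Sum>f\<in>?Q. ?F e f l)"
      by (intro sum.cong refl sum.swap)
    also have "\<dots> = (\<Sum>l=1..R. \<Sum>e\<in>?Q. \<Sum>f\<in>?Q. ?F e f l)" by (rule sum.swap)
    finally show ?thesis .
  qed
  also have "\<dots> = (\<Sum>l=1..R. real (totient l) * (\<Sum>e\<in>?Q. if l dvd e then ?w e / real e else 0)^2)"
    unfolding power2_eq_square sum_product by (simp only: sum_distrib_left)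
  also have "\<dots> = (\<Sum>l=1..R. real (totient l) * (\<Sum>e | e \<in> ?Q \<and> l dvd e. ?w e / real e)^2)"
    by (simp add: sum.inter_filter)
  also have "\<dots> = (\<Sum>l=1..R. real (totient l) * (if l \<in> ?Q then parity_sign l / (real l * ?S) else 0)^2)"
    using assms by (intro sum.cong refl) (simp add: sum_selberg_weight_multiples)
  also have "\<dots> = (\<Sum>l=1..R. if l \<in> ?Q then real (totient l) / (real l * ?S)^2 else 0)"
    by (intro sum.cong) (auto simp: power_divide)
  also have "\<dots> = (\<Sum>l | l \<in> {1..R} \<and> l \<in> ?Q. real (totient l) / (real l * ?S)^2)"
    by (subst sum.inter_filter) auto
  also have "{l. l \<in> {1..R} \<and> l \<in> ?Q} = ?Q" by (auto simp: squarefrees_upto_def)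
  \<comment> \<open>The suboptimal choice of weights enters here, through
    \<open>totient l \<le> l\<close>; what remains is the normaliser divided by its square.\<close>
  also have "(\<Sum>l\<in>?Q. real (totient l) / (real l * ?S)^2) \<le> (\<Sum>l\<in>?Q. 1 / real l / ?S^2)"
  proof (intro sum_mono)
    fix l assume "l \<in> ?Q"
    then have "real (totient l) / (real l * ?S)^2 \<le> real l / (real l * ?S)^2"
      by (intro divide_right_mono) (auto simp: totient_le)
    also have "\<dots> = 1 / real l / ?S^2" by (simp add: power2_eq_square)
    finally show "real (totient l) / (real l * ?S)^2 \<le> 1 / real l / ?S^2" .
  qed
  also have "\<dots> = 1 / ?S"
    using S by (simp only: sum_divide_distrib[symmetric] squarefree_harm_def[symmetric]) (simp add: power2_eq_square)
  finally show ?thesis .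
qed

text \<open>Each term is weighted by the square of the sum \<open>u m\<close> of the weights over
  divisors of \<open>m\<close>. A prime beyond \<open>R\<close> has only the divisor 1 up to
  \<open>R\<close>, so its factor is 1, and elsewhere the square is nonnegative. Expanding it
  produces moduli \<open>lcm e f\<close> up to \<open>R^2\<close>, which is why the remainder is
  controlled that far, and at most \<open>R^2\<close> remainder terms.\<close>

theorem selberg_sieve:
  fixes a :: "nat \<Rightarrow> real"
  assumes "finite I" "0 \<notin> I" "\<And>m. m \<in> I \<Longrightarrow> a m \<ge> 0" "R \<ge> 1" "X \<ge> 0"
    and remainder: "\<And>e. 1 \<le> e \<Longrightarrow> e \<le> R^2 \<Longrightarrow> \<bar>(\<Sum>m | m \<in> I \<and> e dvd m. a m) - X / real e\<bar> \<le> E"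
  shows "(\<Sum>p | p \<in> I \<and> prime p \<and> p > R. a p) \<le> X / squarefree_harm R + real (R^2) * E"
proof -
  let ?Q = "squarefrees_upto R" and ?w = "selberg_weight R"
  let ?r = "\<lambda>e. (\<Sum>m | m \<in> I \<and> e dvd m. a m) - X / real e"
  define u where "u m = (\<Sum>e | e \<in> ?Q \<and> e dvd m. ?w e)" for m
  have E: "E \<ge> 0" using remainder[of 1] assms(4) by fastforce
  have 1: "u p = 1" if "prime p" "p > R" for p
  proof -
    have "{e. e \<in> ?Q \<and> e dvd p} = {1}"
    proof safe
      fix e assume "e \<in> ?Q" "e dvd p"
      then show "e = 1" using that prime_nat_iff[of p] by (auto simp: squarefrees_upto_def)
    qed (use assms(4) in \<open>auto simp: squarefrees_upto_def\<close>)
    then show ?thesis using assms(4) by (simp add: u_def selberg_weight_1 del: One_nat_def)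
  qed
  have "(\<Sum>p | p \<in> I \<and> prime p \<and> p > R. a p) = (\<Sum>p | p \<in> I \<and> prime p \<and> p > R. a p * (u p)^2)"
    using 1 by (intro sum.cong) auto
  also have "\<dots> \<le> (\<Sum>m\<in>I. a m * (u m)^2)"
    using assms by (intro sum_mono2) auto
  also have "\<dots> = (\<Sum>m\<in>I. \<Sum>e\<in>?Q. \<Sum>f\<in>?Q. ?w e * ?w f * (if lcm e f dvd m then a m else 0))"
  proof (intro sum.cong refl)
    fix m
    have "u m = (\<Sum>e\<in>?Q. if e dvd m then ?w e else 0)"
      unfolding u_def by (simp add: sum.inter_filter)
    then have "(u m)^2 = (\<Sum>e\<in>?Q. \<Sum>f\<in>?Q. (if e dvd m then ?w e else 0) * (if f dvd m then ?w f else 0))"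
      by (simp only: power2_eq_square sum_product)
    then have "a m * (u m)^2 = (\<Sum>e\<in>?Q. \<Sum>f\<in>?Q. a m * ((if e dvd m then ?w e else 0) * (if f dvd m then ?w f else 0)))"
      by (simp only: sum_distrib_left)
    also have "\<dots> = (\<Sum>e\<in>?Q. \<Sum>f\<in>?Q. ?w e * ?w f * (if lcm e f dvd m then a m else 0))"
      by (intro sum.cong refl) auto
    finally show "a m * (u m)^2 = \<dots>" .
  qed
  also have "\<dots> = (\<Sum>e\<in>?Q. \<Sum>f\<in>?Q. ?w e * ?w f * (\<Sum>m\<in>I. if lcm e f dvd m then a m else 0))"
    (is "(\<Sum>m\<in>I. \<Sum>e\<in>?Q. \<Sum>f\<in>?Q. ?F e f m) = _")
  proof -
    have "(\<Sum>m\<in>I. \<Sum>e\<in>?Q. \<Sum>f\<in>?Q. ?F e f m) = (\<Sum>e\<in>?Q. \<Sum>m\<in>I. \<Sum>f\<in>?Q. ?F e f m)"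
      by (rule sum.swap)
    also have "\<dots> = (\<Sum>e\<in>?Q. \<Sum>f\<in>?Q. \<Sum>m\<in>I. ?F e f m)"
      by (intro sum.cong refl sum.swap)
    finally show ?thesis by (simp only: sum_distrib_left)
  qed
  also have "\<dots> = (\<Sum>e\<in>?Q. \<Sum>f\<in>?Q. X * (?w e * ?w f / real (lcm e f)) + ?w e * ?w f * ?r (lcm e f))"
    using assms(1) by (intro sum.cong refl) (simp add: sum.inter_filter right_diff_distrib)
  also have "\<dots> = X * (\<Sum>e\<in>?Q. \<Sum>f\<in>?Q. ?w e * ?w f / real (lcm e f))
      + (\<Sum>e\<in>?Q. \<Sum>f\<in>?Q. ?w e * ?w f * ?r (lcm e f))"
    by (simp only: sum.distrib sum_distrib_left)
  also have "\<dots> \<le> X * (1 / squarefree_harm R) + (\<Sum>e\<in>?Q. \<Sum>f\<in>?Q. E)"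
  proof (intro add_mono mult_left_mono selberg_quadratic_form_le sum_mono assms)
    fix e f assume ef: "e \<in> ?Q" "f \<in> ?Q"
    then have pos: "1 \<le> e" "1 \<le> f" "e \<le> R" "f \<le> R" by (auto simp: squarefrees_upto_def)
    then have "lcm e f \<le> e * f" "lcm e f \<ge> 1"
      by (auto intro: dvd_imp_le lcm_least simp: Suc_le_eq lcm_pos_nat)
    moreover have "e * f \<le> R^2" using pos by (simp add: power2_eq_square mult_mono)
    ultimately have r: "\<bar>?r (lcm e f)\<bar> \<le> E" by (intro remainder) auto
    have "?w e * ?w f * ?r (lcm e f) \<le> \<bar>?w e\<bar> * \<bar>?w f\<bar> * \<bar>?r (lcm e f)\<bar>"
      by (metis abs_ge_self abs_mult)
    also have "\<dots> \<le> 1 * 1 * E"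
      using pos r assms(4) by (intro mult_mono abs_selberg_weight_le) auto
    finally show "?w e * ?w f * ?r (lcm e f) \<le> E" by simp
  qed
  also have "(\<Sum>e\<in>?Q. \<Sum>f\<in>?Q. E) \<le> real (R^2) * E"
  proof -
    have "card ?Q \<le> card {1..R}" by (intro card_mono) (auto simp: squarefrees_upto_def)
    then have "real (card ?Q) * real (card ?Q) * E \<le> real R * real R * E"
      using E by (intro mult_mono) auto
    then show ?thesis by (simp add: power2_eq_square mult.assoc)
  qed
  finally show ?thesis by simp
qed

section \<open>Logarithmic lower bound for the squarefree harmonic sum\<close>

lemma sum_inverse_squares_le: "(\<Sum>a=1..n. 1 / (real a)^2) \<le> 2"
proof -
  \<comment> \<open>The subtracted term makes the induction telescope.\<close>
  have "(\<Sum>a=1..Suc n. 1 / (real a)^2) \<le> 2 - 1 / real (Suc n)" for n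
  proof (induction n)
    case (Suc n)
    have "1 / (real (Suc (Suc n)))^2 \<le> 1 / real (Suc n) - 1 / real (Suc (Suc n))"
      by (simp add: divide_simps power2_eq_square)
    with Suc show ?case by simp
  qed auto
  from this[of "n - 1"] show ?thesis
    by (cases n) (auto intro: order_trans)
qed

text \<open>Every \<open>m\<close> is uniquely a squarefree number times a square, so the harmonic
  sum is at most \<open>squarefree_harm R\<close> times the sum of inverse squares, which is at most
  2.\<close>

lemma squarefree_harm_ge: "squarefree_harm R \<ge> ln (real R + 1) / 2"
proof -
  let ?Q = "squarefrees_upto R"
  let ?d = "\<lambda>m::nat. (square_part m, squarefree_part m)"
  have inj: "inj_on ?d {1..R}"
    by (rule inj_onI) (auto intro: squarefree_decomposition_unique)
  have "ln (real R + 1) \<le> (\<Sum>m=1..R. 1 / real m)" 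
    using sum_inverse_bounds(1)[of 1 "R + 1"] by (simp add: atLeastLessThanSuc_atLeastAtMost add.commute)
  also have "\<dots> = (\<Sum>m=1..R. (\<lambda>(a,b). 1 / (real a)^2 * (1 / real b)) (?d m))"
  proof (intro sum.cong refl)
    fix m
    have "real m = real (squarefree_part m) * real (square_part m)^2"
      using arg_cong[OF squarefree_decompose[of m], of real] by simp
    then show "1 / real m = (\<lambda>(a,b). 1 / (real a)^2 * (1 / real b)) (?d m)" by simp
  qed
  also have "\<dots> = (\<Sum>x\<in>?d ` {1..R}. (\<lambda>(a,b). 1 / (real a)^2 * (1 / real b)) x)"
    by (rule sum.reindex[OF inj, symmetric, unfolded o_def])
  also have "\<dots> \<le> (\<Sum>x\<in>{1..R} \<times> ?Q. (\<lambda>(a,b). 1 / (real a)^2 * (1 / real b)) x)"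
  proof (intro sum_mono2)
    show "?d ` {1..R} \<subseteq> {1..R} \<times> ?Q"
    proof clarify
      fix m assume m: "m \<in> {1..R}"
      have "square_part m dvd squarefree_part m * (square_part m)^2"
        "squarefree_part m dvd squarefree_part m * (square_part m)^2" by simp_all
      then have "square_part m dvd m" "squarefree_part m dvd m"
        by (simp_all only: squarefree_decompose[of m, symmetric])
      with m have "square_part m \<le> R" "squarefree_part m \<le> R"
        by (auto dest!: dvd_imp_le)
      moreover have "square_part m > 0" "squarefree_part m > 0" using m
        by (auto intro!: Nat.gr0I)
      ultimately show "square_part m \<in> {1..R} \<and> squarefree_part m \<in> ?Q"
        by (auto simp: squarefrees_upto_def)
    qed
  qed auto
  also have "\<dots> = (\<Sum>a=1..R. 1 / (real a)^2) * squarefree_harm R"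
    by (simp add: sum.cartesian_product[symmetric] sum_product squarefree_harm_def)
  also have "\<dots> \<le> 2 * squarefree_harm R"
    by (intro mult_right_mono sum_inverse_squares_le) (auto simp: squarefree_harm_def intro!: sum_nonneg)
  finally show ?thesis by simp
qed

section \<open>Sawtooth sums over reciprocals\<close>

definition sawtooth :: "real \<Rightarrow> real" where
  "sawtooth x = frac x - 1 / 2"

lemma abs_sawtooth_le: "\<bar>sawtooth x\<bar> \<le> 1 / 2"
  using frac_ge_0[of x] frac_lt_1[of x] by (simp add: sawtooth_def abs_if)

text \<open>Let \<open>t\<close> be the integer part of \<open>q * \<alpha>\<close>. As
  \<open>a\<close> is invertible modulo \<open>q\<close>, the residues of \<open>t - h * a\<close>
  run through all of \<open>0, ..., q - 1\<close>. The fractional parts are therefore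
  \<open>(r + \<beta>) / q\<close>, each residue \<open>r\<close> occurring once, with the common
  offset \<open>\<beta> = frac (q * \<alpha>)\<close>.\<close>

lemma sum_frac_arith_progression:
  fixes a :: int and \<alpha> :: real
  assumes "q > 0" "coprime a (int q)"
  shows "(\<Sum>h<q. frac (\<alpha> - real h * of_int a / real q)) = (real q - 1) / 2 + frac (real q * \<alpha>)"
proof -
  define t where "t = \<lfloor>real q * \<alpha>\<rfloor>"
  define \<beta> where "\<beta> = frac (real q * \<alpha>)"
  define \<phi> where "\<phi> h = nat ((t - int h * a) mod int q)" for h
  have \<beta>: "0 \<le> \<beta>" "\<beta> < 1" and q\<alpha>: "real q * \<alpha> = of_int t + \<beta>"
    unfolding \<beta>_def t_def by (rule frac_ge_0, rule frac_lt_1, simp add: frac_def)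
  have \<phi>_lt: "\<phi> h < q" for h
    using assms(1) by (simp add: \<phi>_def nat_less_iff)
  have "inj_on \<phi> {..<q}"
  proof (rule inj_onI)
    fix h h' assume h: "h \<in> {..<q}" "h' \<in> {..<q}" and eq: "\<phi> h = \<phi> h'"
    have "(t - int h * a) mod int q = (t - int h' * a) mod int q"
      using eq assms(1) by (simp add: \<phi>_def eq_nat_nat_iff)
    then have "int q dvd (t - int h * a) - (t - int h' * a)"
      by (simp only: mod_eq_dvd_iff)
    then have "int q dvd (int h' - int h) * a" by (simp add: algebra_simps)
    then have "int q dvd int h' - int h"
      using assms(2) by (simp add: coprime_commute coprime_dvd_mult_left_iff)
    moreover have "\<bar>int h' - int h\<bar> < int q" using h by auto
    ultimately have "int h' - int h = 0"
      using dvd_imp_le_int[of "int h' - int h" "int q"] by linarith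
    then show "h = h'" by simp
  qed
  then have bij: "bij_betw \<phi> {..<q} {..<q}"
    using \<phi>_lt by (intro bij_betw_imageI endo_inj_surj) auto
  have frac: "frac (\<alpha> - real h * of_int a / real q) = (real (\<phi> h) + \<beta>) / real q" for h
  proof -
    let ?u = "t - int h * a"
    have \<phi>h: "real (\<phi> h) = of_int (?u mod int q)"
      using assms(1) by (simp add: \<phi>_def of_nat_nat)
    have "\<alpha> - real h * of_int a / real q = (of_int ?u + \<beta>) / real q"
      using assms(1) q\<alpha> by (simp add: field_simps)
    also have "real_of_int ?u = of_int (?u div int q) * real q + of_int (?u mod int q)"
      by (metis div_mult_mod_eq of_int_add of_int_mult of_int_of_nat_eq)
    finally have "\<alpha> - real h * of_int a / real q - (real (\<phi> h) + \<beta>) / real q = of_int (?u div int q)"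
      using assms(1) \<phi>h by (simp add: field_simps)
    moreover have "real (\<phi> h) + 1 \<le> real q" using \<phi>_lt[of h] by linarith
    then have "(real (\<phi> h) + \<beta>) / real q < 1" using \<beta> assms(1) by (simp add: divide_simps)
    ultimately show ?thesis using \<beta> by (subst frac_unique_iff) (auto simp: Ints_def)
  qed
  have "(\<Sum>h<q. frac (\<alpha> - real h * of_int a / real q)) = ((\<Sum>h<q. real (\<phi> h)) + real q * \<beta>) / real q"
    unfolding frac by (simp add: sum_divide_distrib[symmetric] sum.distrib)
  also have "(\<Sum>h<q. real (\<phi> h)) = (\<Sum>r<q. real r)"
    by (rule sum.reindex_bij_betw[OF bij])
  also have "(\<Sum>r<q. real r) = real q * (real q - 1) / 2"
    by (induction q) (auto simp: field_simps)
  also have "(real q * (real q - 1) / 2 + real q * \<beta>) / real q = (real q - 1) / 2 + \<beta>"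
    using assms(1) by (simp add: add_divide_distrib)
  finally show ?thesis by (simp add: \<beta>_def)
qed

text \<open>A perturbation may carry a term across an integer, so fractional parts cannot be
  compared directly. Instead each \<open>x h\<close> is enclosed between the progressions shifted by
  \<open>-E\<close> and \<open>E\<close>, and monotonicity of the floor costs \<open>2 * E\<close>
  per term, hence at most 4 over the block.\<close>

lemma abs_sum_sawtooth_le_near_progression:
  fixes a :: int and \<alpha> E :: real and x :: "nat \<Rightarrow> real"
  assumes "q > 0" "coprime a (int q)"
    and near: "\<And>h. h < q \<Longrightarrow> \<bar>x h - (\<alpha> - real h * of_int a / real q)\<bar> \<le> E"
    and E: "real q * E \<le> 2"
  shows "\<bar>\<Sum>h<q. sawtooth (x h)\<bar> \<le> 5"
proof -
  let ?z = "\<lambda>\<alpha> h. \<alpha> - real h * of_int a / real q"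
  have "frac (?z (\<alpha> + E) h) - 2 * E - 1 / 2 \<le> sawtooth (x h)
      \<and> sawtooth (x h) \<le> frac (?z (\<alpha> - E) h) + 2 * E - 1 / 2" if "h < q" for h
  proof -
    have x: "?z (\<alpha> - E) h \<le> x h" "x h \<le> ?z (\<alpha> + E) h" using near[OF that] by (auto simp: abs_le_iff)
    then have "\<lfloor>?z (\<alpha> - E) h\<rfloor> \<le> \<lfloor>x h\<rfloor>" "\<lfloor>x h\<rfloor> \<le> \<lfloor>?z (\<alpha> + E) h\<rfloor>" by (auto intro: floor_mono)
    then have "real_of_int \<lfloor>?z (\<alpha> - E) h\<rfloor> \<le> of_int \<lfloor>x h\<rfloor>" "real_of_int \<lfloor>x h\<rfloor> \<le> of_int \<lfloor>?z (\<alpha> + E) h\<rfloor>"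
      by linarith+
    with x show ?thesis by (simp add: sawtooth_def frac_def)
  qed
  then have "(\<Sum>h<q. frac (?z (\<alpha> + E) h) - 2 * E - 1 / 2) \<le> (\<Sum>h<q. sawtooth (x h))"
    "(\<Sum>h<q. sawtooth (x h)) \<le> (\<Sum>h<q. frac (?z (\<alpha> - E) h) + 2 * E - 1 / 2)"
    by (auto intro!: sum_mono)
  moreover have "(\<Sum>h<q. frac (?z (\<alpha> + E) h) - 2 * E - 1 / 2)
      = (real q - 1) / 2 + frac (real q * (\<alpha> + E)) - real q * (2 * E) - real q / 2"
    using sum_frac_arith_progression[OF assms(1,2), of "\<alpha> + E"]
    by (simp add: sum_subtractf sum.distrib)
  moreover have "(\<Sum>h<q. frac (?z (\<alpha> - E) h) + 2 * E - 1 / 2)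
      = (real q - 1) / 2 + frac (real q * (\<alpha> - E)) + real q * (2 * E) - real q / 2"
    using sum_frac_arith_progression[OF assms(1,2), of "\<alpha> - E"]
    by (simp add: sum_subtractf sum.distrib)
  ultimately have "- 5 \<le> (\<Sum>h<q. sawtooth (x h))" "(\<Sum>h<q. sawtooth (x h)) \<le> 5"
    using E frac_ge_0[of "real q * (\<alpha> + E)"] frac_lt_1[of "real q * (\<alpha> - E)"]
    by (simp_all only: diff_divide_distrib)
  then show ?thesis by linarith
qed

text \<open>The slope of \<open>y / j\<close> at \<open>m\<close> is \<open>- y / m^2\<close>.
  Replacing it by \<open>- a / q\<close> costs at most \<open>1 / Q\<close> over the block, and the
  second-order term costs at most \<open>Q^2 * y / A^3\<close>; the condition on
  \<open>Q^3 * y\<close> keeps \<open>q\<close> times the total at most 2.\<close>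

lemma abs_sum_sawtooth_reciprocal_block:
  fixes y :: real and a :: int
  assumes "y > 0" "0 < A" "A \<le> m" "0 < q" "q \<le> Q" "coprime a (int q)"
    and approx: "\<bar>real q * (y / (real m)^2) - of_int a\<bar> < 1 / real Q"
    and Q: "(real Q)^3 * y \<le> (real A)^3"
  shows "\<bar>\<Sum>j=m..<m+q. sawtooth (y / real j)\<bar> \<le> 5"
proof -
  let ?E = "1 / real Q + (real Q)^2 * y / (real A)^3"
  have pos: "real m > 0" "real A > 0" "real q > 0" "real Q > 0" using assms by auto
  have "\<bar>y / real (m + h) - (y / real m - real h * of_int a / real q)\<bar> \<le> ?E" if h: "h < q" for h
  proof -
    have "y / real (m + h) - (y / real m - real h * of_int a / real q)
      = - (real h / real q) * (real q * (y / (real m)^2) - of_int a)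
        + (real h)^2 * y / ((real m)^2 * real (m + h))"
      using pos by (simp add: divide_simps power2_eq_square) (simp add: algebra_simps)
    moreover have "\<bar>- (real h / real q) * (real q * (y / (real m)^2) - of_int a)\<bar> \<le> 1 / real Q"
    proof -
      have "real h / real q \<le> 1" using h by simp
      then have "(real h / real q) * \<bar>real q * (y / (real m)^2) - of_int a\<bar> \<le> 1 * (1 / real Q)"
        using approx by (intro mult_mono) auto
      then show ?thesis by (simp add: abs_mult)
    qed
    moreover have "\<bar>(real h)^2 * y / ((real m)^2 * real (m + h))\<bar> \<le> (real Q)^2 * y / (real A)^3"
    proof -
      have "(real h)^2 * y / ((real m)^2 * real (m + h)) \<le> (real Q)^2 * y / ((real A)^2 * real A)"
        using h assms pos by (intro frac_le mult_mono power_mono) auto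
      then show ?thesis using assms(1) by (simp add: power2_eq_square power3_eq_cube)
    qed
    ultimately show ?thesis by linarith
  qed
  moreover have "real q * ?E \<le> 2"
  proof -
    have "real q * ?E \<le> real Q * ?E" using assms by (intro mult_right_mono) auto
    also have "\<dots> = 1 + (real Q)^3 * y / (real A)^3"
      using pos by (simp add: field_simps power2_eq_square power3_eq_cube)
    also have "\<dots> \<le> 1 + 1" using Q pos by (intro add_left_mono) (simp add: divide_simps)
    finally show ?thesis by simp
  qed
  ultimately have "\<bar>\<Sum>h<q. sawtooth (y / real (m + h))\<bar> \<le> 5"
    using assms by (intro abs_sum_sawtooth_le_near_progression) auto
  also have "(\<Sum>h<q. sawtooth (y / real (m + h))) = (\<Sum>j=m..<m+q. sawtooth (y / real j))"
    using sum.shift_bounds_nat_ivl[of "\<lambda>j. sawtooth (y / real j)" 0 m q]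
    by (simp add: atLeast0LessThan add.commute)
  finally show ?thesis .
qed

text \<open>These are the bad starting points: Dirichlet's theorem may return a denominator below
  \<open>q\<^sub>0\<close> there, and a bound of 5 for so short a block would be too
  expensive.\<close>

definition near_small_fraction :: "real \<Rightarrow> nat \<Rightarrow> nat \<Rightarrow> nat \<Rightarrow> bool" where
  "near_small_fraction y Q q\<^sub>0 m \<longleftrightarrow>
     (\<exists>q a. 0 < q \<and> q < q\<^sub>0 \<and> \<bar>real q * (y / (real m)^2) - of_int a\<bar> < 1 / real Q)"

text \<open>Greedy covering: from \<open>m\<close>, jump over a whole block of length \<open>q\<close> whenever Dirichlet's
  theorem gives a denominator \<open>q \<ge> q\<^sub>0\<close>, and over a single point otherwise.\<close>
lemma abs_sum_sawtooth_reciprocal_greedy: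
  fixes y :: real
  assumes "y > 0" "0 < A" "0 < Q" "0 < q\<^sub>0" and Q: "(real Q)^3 * y \<le> (real A)^3"
    and "A \<le> m" "m \<le> B"
  shows "\<bar>\<Sum>j=m..<B. sawtooth (y / real j)\<bar>
    \<le> real (card {j\<in>{m..<B}. near_small_fraction y Q q\<^sub>0 j}) + 5 * real (B - m) / real q\<^sub>0 + real Q"
  using assms(6,7)
proof (induction "B - m" arbitrary: m rule: less_induct)
  case less
  let ?s = "\<lambda>j. sawtooth (y / real j)" and ?b = "near_small_fraction y Q q\<^sub>0"
  let ?c = "\<lambda>m. real (card {j\<in>{m..<B}. ?b j})"
  show ?case
  \<comment> \<open>The incomplete last piece is estimated trivially and accounts for the summand
    \<open>Q\<close>. In the other case no block of length at most \<open>Q\<close> can overshoot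
    \<open>B\<close>.\<close>
  proof (cases "B - m < Q")
    case True
    have "\<bar>\<Sum>j=m..<B. ?s j\<bar> \<le> (\<Sum>j=m..<B. \<bar>?s j\<bar>)" by (rule sum_abs)
    also have "\<dots> \<le> (\<Sum>j=m..<B. 1 / 2)" by (intro sum_mono abs_sawtooth_le)
    also have "\<dots> \<le> real Q" using True by simp
    finally show ?thesis by (rule order_trans) simp
  next
    case False
    then have mB: "m < B" using assms(3) by linarith
    show ?thesis
    proof (cases "?b m")
      case True
      have "\<bar>\<Sum>j=Suc m..<B. ?s j\<bar> \<le> ?c (Suc m) + 5 * real (B - Suc m) / real q\<^sub>0 + real Q"
        using mB less.prems by (intro less.hyps) auto
      also have "5 * real (B - Suc m) / real q\<^sub>0 \<le> 5 * real (B - m) / real q\<^sub>0"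
        by (intro divide_right_mono) auto
      finally have *: "\<bar>\<Sum>j=Suc m..<B. ?s j\<bar> \<le> ?c (Suc m) + 5 * real (B - m) / real q\<^sub>0 + real Q" by simp
      have "{j\<in>{m..<B}. ?b j} = insert m {j\<in>{Suc m..<B}. ?b j}"
        using True mB by (auto simp: le_less Suc_le_eq)
      then have "?c m = ?c (Suc m) + 1" by simp
      moreover have "(\<Sum>j=m..<B. ?s j) = ?s m + (\<Sum>j=Suc m..<B. ?s j)"
        using mB by (simp add: sum.atLeast_Suc_lessThan)
      ultimately show ?thesis using * abs_sawtooth_le[of "y / real m"] by linarith
    next
      case good: False
      obtain a k where ak: "coprime a k" "0 < k" "k \<le> int Q"
          "\<bar>of_int k * (y / (real m)^2) - of_int a\<bar> < 1 / real Q"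
        using Dirichlet_approx_coprime[OF assms(3)] by blast
      define q where "q = nat k"
      have q: "coprime a (int q)" "0 < q" "q \<le> Q" "\<bar>real q * (y / (real m)^2) - of_int a\<bar> < 1 / real Q"
        using ak by (auto simp: q_def nat_le_iff)
      with good have q0: "q\<^sub>0 \<le> q" unfolding near_small_fraction_def by (meson not_less)
      have qB: "m + q \<le> B" using False q(3) mB by linarith
      have "\<bar>\<Sum>j=m..<m+q. ?s j\<bar> \<le> 5"
        using assms less.prems q by (intro abs_sum_sawtooth_reciprocal_block[where A = A and Q = Q and a = a]) auto
      moreover have "\<bar>\<Sum>j=m+q..<B. ?s j\<bar> \<le> ?c (m + q) + 5 * real (B - (m + q)) / real q\<^sub>0 + real Q"
        using qB less.prems q(2) by (intro less.hyps) auto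
      moreover have "(\<Sum>j=m..<B. ?s j) = (\<Sum>j=m..<m+q. ?s j) + (\<Sum>j=m+q..<B. ?s j)"
        using qB by (simp add: sum.atLeastLessThan_concat)
      moreover have "?c (m + q) \<le> ?c m"
        by (intro of_nat_mono card_mono) auto
      \<comment> \<open>The cost 5 of a block is paid by its own length:
        \<open>q \<ge> q\<^sub>0\<close> points release at least 5 from the middle term.\<close>
      moreover have "5 + 5 * real (B - (m + q)) / real q\<^sub>0 \<le> 5 * real (B - m) / real q\<^sub>0"
      proof -
        have "5 * real (B - m) / real q\<^sub>0 = 5 * (real q / real q\<^sub>0) + 5 * real (B - (m + q)) / real q\<^sub>0"
          using qB assms(4) by (simp add: of_nat_diff field_simps)
        moreover have "real q / real q\<^sub>0 \<ge> 1" using q0 assms(4) by simp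
        ultimately show ?thesis by linarith
      qed
      ultimately show ?thesis by linarith
    qed
  qed
qed

text \<open>Between the extreme solutions \<open>u\<close> and \<open>v\<close> the decreasing
  function \<open>y / m^2\<close> drops by at least \<open>(v - u) * y / B^3\<close>, whereas all
  solutions have values within \<open>2 * w\<close> of each other even after multiplication by
  \<open>q \<ge> 1\<close>.\<close>

lemma card_reciprocal_square_near_le:
  fixes y \<theta> w :: real
  assumes "y > 0" "0 < q" "0 < A" "w > 0"
  shows "real (card {m\<in>{A..<B}. \<bar>real q * (y / (real m)^2) - \<theta>\<bar> < w}) \<le> 2 * w * (real B)^3 / y + 1"
    (is "real (card ?S) \<le> _")
proof (cases "?S = {}")
  case True
  then show ?thesis using assms by (simp only: True card.empty) simp
next
  case False
  define u v where "u = Min ?S" and "v = Max ?S"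
  have fin: "finite ?S" by simp
  have u: "u \<in> ?S" and v: "v \<in> ?S" unfolding u_def v_def using False fin Min_in Max_in by blast+
  have sub: "?S \<subseteq> {u..v}" unfolding u_def v_def using fin by auto
  have uv: "u \<le> v" using v sub by auto
  have "card ?S \<le> card {u..v}" by (rule card_mono) (use sub in auto)
  then have c: "real (card ?S) \<le> real v - real u + 1" using uv by simp
  have pos: "0 < real u" "0 < real v" "real u \<le> real v" "real v \<le> real B"
    using u v uv assms(3) by auto
  have "real q * (y / (real u)^2) - real q * (y / (real v)^2) \<le> 2 * w"
    using u v by (auto simp: abs_less_iff)
  moreover have "y / (real u)^2 - y / (real v)^2 \<le> real q * (y / (real u)^2) - real q * (y / (real v)^2)"
  proof -
    have "y / (real v)^2 \<le> y / (real u)^2" using pos assms by (intro divide_left_mono power_mono) auto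
    then have "1 * (y / (real u)^2 - y / (real v)^2) \<le> real q * (y / (real u)^2 - y / (real v)^2)"
      using assms by (intro mult_right_mono) auto
    then show ?thesis by (simp add: right_diff_distrib)
  qed
  moreover have "(real v - real u) * (y / (real B)^3) \<le> y / (real u)^2 - y / (real v)^2"
  proof -
    have "(real u)^2 * real v \<le> (real B)^2 * real B" using pos by (intro mult_mono power_mono) auto
    then have "(real v - real u) * (y / (real B)^3) \<le> (real v - real u) * (y / ((real u)^2 * real v))"
      using pos assms by (intro mult_left_mono divide_left_mono) (auto simp: power2_eq_square power3_eq_cube)
    also have "\<dots> = y * (real v - real u) * real v / ((real u)^2 * (real v)^2)"
      using pos by (simp add: power2_eq_square mult_ac)
    also have "\<dots> \<le> y * (real v - real u) * (real v + real u) / ((real u)^2 * (real v)^2)"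
      using pos assms by (intro divide_right_mono mult_left_mono) auto
    also have "\<dots> = y / (real u)^2 - y / (real v)^2"
      using pos by (simp add: field_simps power2_eq_square)
    finally show ?thesis .
  qed
  ultimately have "(real v - real u) * (y / (real B)^3) \<le> 2 * w" by linarith
  then have "real v - real u \<le> 2 * w * (real B)^3 / y"
    using pos assms by (simp add: field_simps)
  with c show ?thesis by linarith
qed

text \<open>A union bound over the fractions \<open>a / q\<close> with \<open>q < q\<^sub>0\<close>:
  the range of \<open>y / m^2\<close> limits the numerators, and each fraction attracts few
  \<open>m\<close> by the preceding lemma.\<close>

lemma card_near_small_fraction_le:
  fixes y :: real
  assumes "y > 0" "0 < A" "0 < Q"
  shows "real (card {j\<in>{A..<B}. near_small_fraction y Q q\<^sub>0 j})
    \<le> real q\<^sub>0 * (real q\<^sub>0 * y / (real A)^2 + 2) * (2 * (real B)^3 / (real Q * y) + 1)"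
proof -
  \<comment> \<open>Every admissible numerator lies in \<open>{0..K}\<close>, which has
    \<open>K + 1\<close> elements; this is the source of the summand 2 in the bound.\<close>
  define K where "K = \<lfloor>real q\<^sub>0 * y / (real A)^2\<rfloor> + 1"
  define T where "T q a = {m\<in>{A..<B}. \<bar>real q * (y / (real m)^2) - of_int a\<bar> < 1 / real Q}" for q :: nat and a :: int
  define C where "C = 2 * (real B)^3 / (real Q * y) + 1"
  have K: "K \<ge> 1" using assms by (auto simp: K_def)
  have C: "C \<ge> 0" using assms by (auto simp: C_def)
  have "{j\<in>{A..<B}. near_small_fraction y Q q\<^sub>0 j} \<subseteq> (\<Union>q\<in>{1..<q\<^sub>0}. \<Union>a\<in>{0..K}. T q a)"
  proof
    fix m assume "m \<in> {j\<in>{A..<B}. near_small_fraction y Q q\<^sub>0 j}"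
    then obtain q a where m: "m \<in> {A..<B}" and q: "0 < q" "q < q\<^sub>0"
        and a: "\<bar>real q * (y / (real m)^2) - of_int a\<bar> < 1 / real Q"
      by (auto simp: near_small_fraction_def)
    have Q1: "1 / real Q \<le> 1" using assms by simp
    have "0 \<le> real q * (y / (real m)^2)" using assms by auto
    with a Q1 have "real_of_int a > -1" by linarith
    then have "a \<ge> 0" by linarith
    moreover have "real q * (y / (real m)^2) \<le> real q\<^sub>0 * (y / (real A)^2)"
      using assms q m by (intro mult_mono divide_left_mono power_mono) auto
    with a Q1 have "real_of_int a < real q\<^sub>0 * y / (real A)^2 + 1" by simp
    then have "a \<le> K" unfolding K_def by linarith
    ultimately show "m \<in> (\<Union>q\<in>{1..<q\<^sub>0}. \<Union>a\<in>{0..K}. T q a)"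
      using q m a by (force simp: T_def)
  qed
  then have "card {j\<in>{A..<B}. near_small_fraction y Q q\<^sub>0 j} \<le> card (\<Union>q\<in>{1..<q\<^sub>0}. \<Union>a\<in>{0..K}. T q a)"
    by (intro card_mono) (auto simp: T_def)
  also have "\<dots> \<le> (\<Sum>q\<in>{1..<q\<^sub>0}. card (\<Union>a\<in>{0..K}. T q a))" by (rule card_UN_le) simp
  also have "\<dots> \<le> (\<Sum>q\<in>{1..<q\<^sub>0}. \<Sum>a\<in>{0..K}. card (T q a))"
    by (intro sum_mono card_UN_le) simp
  finally have "real (card {j\<in>{A..<B}. near_small_fraction y Q q\<^sub>0 j})
      \<le> real (\<Sum>q\<in>{1..<q\<^sub>0}. \<Sum>a\<in>{0..K}. card (T q a))" by (rule of_nat_mono)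
  also have "\<dots> = (\<Sum>q\<in>{1..<q\<^sub>0}. \<Sum>a\<in>{0..K}. real (card (T q a)))" by simp
  also have "\<dots> \<le> (\<Sum>q\<in>{1..<q\<^sub>0}. \<Sum>a\<in>{0..K}. C)"
  proof (intro sum_mono)
    fix q a assume "q \<in> {1..<q\<^sub>0}"
    then have "real (card (T q a)) \<le> 2 * (1 / real Q) * (real B)^3 / y + 1"
      unfolding T_def using assms by (intro card_reciprocal_square_near_le) auto
    then show "real (card (T q a)) \<le> C" by (simp add: C_def)
  qed
  also have "\<dots> = real (q\<^sub>0 - 1) * (of_int (K + 1) * C)" using K by (simp add: algebra_simps)
  also have "\<dots> \<le> real q\<^sub>0 * ((real q\<^sub>0 * y / (real A)^2 + 2) * C)"
    using C K unfolding K_def by (intro mult_mono) (auto intro!: mult_nonneg_nonneg)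
  finally show ?thesis by (simp add: C_def mult.assoc)
qed

text \<open>For \<open>A\<close> and \<open>B\<close> of order \<open>sqrt y\<close>, the hypothesis
  admits \<open>Q\<close> up to order \<open>y powr (1/6)\<close>. Taking \<open>q\<^sub>0\<close> a
  small power of \<open>Q\<close> then saves a power of \<open>y\<close> over the trivial
  bound.\<close>

theorem abs_sum_sawtooth_reciprocal_le:
  fixes y :: real
  assumes "y > 0" "0 < A" "A \<le> B" "0 < Q" "0 < q\<^sub>0" "(real Q)^3 * y \<le> (real A)^3"
  shows "\<bar>\<Sum>j=A..<B. sawtooth (y / real j)\<bar>
    \<le> real q\<^sub>0 * (real q\<^sub>0 * y / (real A)^2 + 2) * (2 * (real B)^3 / (real Q * y) + 1)
      + 5 * real B / real q\<^sub>0 + real Q"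
proof -
  have "5 * real (B - A) / real q\<^sub>0 \<le> 5 * real B / real q\<^sub>0" by (intro divide_right_mono) auto
  with abs_sum_sawtooth_reciprocal_greedy[OF assms(1,2,4,5,6) order_refl assms(3)]
    card_near_small_fraction_le[OF assms(1,2,4), of B q\<^sub>0]
  show ?thesis by linarith
qed

section \<open>Prime factors of consecutive integers\<close>

text \<open>The sieve is applied to all integers up to \<open>k\<close> at level
  \<open>k powr (1/4)\<close>. The remainder is at most 1 for each modulus, and the main term is of
  order \<open>k / ln k\<close>.\<close>

lemma eventually_card_primes_le:
  assumes "c > 0"
  shows "\<forall>\<^sub>F k in sequentially. real (card {p. prime p \<and> p \<le> k}) \<le> c * real k"
proof -
  have "\<forall>\<^sub>F k in sequentially. real k powr (1/4) + real k / (ln (real k powr (1/4)) / 2) + real k powr (1/2) \<le> c * real k"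
    using assms by real_asymp
  moreover have "\<forall>\<^sub>F k::nat in sequentially. k \<ge> 2" by (rule eventually_ge_at_top)
  ultimately show ?thesis
  proof eventually_elim
    case (elim k)
    define R where "R = nat \<lfloor>real k powr (1/4)\<rfloor>"
    have k1: "real k powr (1/4) > 1" using elim by simp
    then have R: "R \<ge> 1" "real R \<le> real k powr (1/4)" "real k powr (1/4) \<le> real R + 1"
      using nat_floor_bounds[of "real k powr (1/4)"] unfolding R_def by simp_all
    have "(\<Sum>p | p \<in> {1..k} \<and> prime p \<and> p > R. 1) \<le> real k / squarefree_harm R + real (R^2) * 1"
    proof (intro selberg_sieve R)
      fix e :: nat assume e: "1 \<le> e"
      have "{m. m \<in> {1..k} \<and> e dvd m} = (*) e ` {1..k div e}"
        using e by (auto simp: div_le_mono less_eq_div_iff_mult_less_eq mult.commute elim!: dvdE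
          intro!: imageI)
      then have "card {m. m \<in> {1..k} \<and> e dvd m} = k div e"
        using e by (simp add: card_image inj_on_def)
      then have "(\<Sum>m | m \<in> {1..k} \<and> e dvd m. 1) = real_of_int \<lfloor>real k / real e\<rfloor>"
        by (simp add: floor_divide_of_nat_eq)
      then show "\<bar>(\<Sum>m | m \<in> {1..k} \<and> e dvd m. 1) - real k / real e\<bar> \<le> 1"
        by linarith
    qed auto
    moreover have "real k / squarefree_harm R \<le> real k / (ln (real k powr (1/4)) / 2)"
    proof (intro divide_left_mono)
      have "ln (real k powr (1/4)) \<le> ln (real R + 1)" using R(3) k1 by (intro ln_mono) linarith+
      with squarefree_harm_ge[of R] show "ln (real k powr (1/4)) / 2 \<le> squarefree_harm R" by linarith
      show "0 < squarefree_harm R * (ln (real k powr (1/4)) / 2)"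
        using squarefree_harm_pos[OF R(1)] k1 elim by simp
    qed auto
    moreover have "real (R^2) \<le> real k powr (1/2)"
    proof -
      have "real (R^2) \<le> (real k powr (1/4))^2" using R by (simp add: power_mono)
      also have "\<dots> = real k powr (1/2)" using elim by (simp add: powr_power)
      finally show ?thesis .
    qed
    moreover have "real (card {p. prime p \<and> p \<le> k}) \<le> real R + (\<Sum>p | p \<in> {1..k} \<and> prime p \<and> p > R. 1)"
    proof -
      have "{p. prime p \<and> p \<le> k} \<subseteq> {1..R} \<union> {p. p \<in> {1..k} \<and> prime p \<and> p > R}"
        by (auto dest: prime_gt_0_nat)
      then have "card {p. prime p \<and> p \<le> k} \<le> card ({1..R} \<union> {p. p \<in> {1..k} \<and> prime p \<and> p > R})"
        by (rule card_mono[rotated]) auto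
      also have "\<dots> \<le> R + card {p. p \<in> {1..k} \<and> prime p \<and> p > R}"
        by (rule order_trans[OF card_Un_le]) simp
      finally show ?thesis by simp
    qed
    ultimately show ?case using elim R by linarith
  qed
qed

text \<open>Here \<open>6271/12800 = \<gamma> - 2\<rho>\<close>, the size of \<open>k / e\<close> for the largest sieve modulus \<open>e\<close>, and
  \<open>6239/12800 = \<gamma> - 1/80\<close> is a saving that outweighs the factor \<open>n powr (2\<rho>)\<close> lost in the sieve.\<close>
lemma eventually_sum_sawtooth_le:
  "\<forall>\<^sub>F n::nat in sequentially. \<forall>y A B. real n powr (99/100) \<le> y \<longrightarrow> y \<le> 2 * real n \<longrightarrow>
     real n powr (6271/12800) \<le> real A \<longrightarrow> A \<le> B \<longrightarrow> real B \<le> 2 * real n powr (801/1600) \<longrightarrow>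
     \<bar>\<Sum>j=A..<B. sawtooth (y / real j)\<bar> \<le> real n powr (6239/12800)"
proof -
  have "\<forall>\<^sub>F n::nat in sequentially. (real n powr (1/8))^3 * (2 * real n) \<le> (real n powr (6271/12800))^3"
    by real_asymp
  moreover have "\<forall>\<^sub>F n::nat in sequentially.
      real n powr (1/40) * (real n powr (1/40) * (2 * real n) / (real n powr (6271/12800))^2 + 2) *
        (2 * (2 * real n powr (801/1600))^3 / (real n powr (1/8) / 2 * real n powr (99/100)) + 1)
      + 5 * (2 * real n powr (801/1600)) / (real n powr (1/40) / 2) + real n powr (1/8)
      \<le> real n powr (6239/12800)"
    by real_asymp
  moreover have "\<forall>\<^sub>F n::nat in sequentially. n \<ge> 2" by (rule eventually_ge_at_top)
  ultimately show ?thesis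
  proof eventually_elim
    case (elim n)
    \<comment> \<open>With these sizes \<open>Q^3 * y\<close> has exponent at most 11/8, below three
      times 6271/12800. The dominant term of the bound is \<open>5 * B / q\<close>, of exponent
      801/1600 - 1/40 = 761/1600, below 6239/12800; the bad points contribute an exponent of about
      0.457.\<close>
    define Q where "Q = nat \<lfloor>real n powr (1/8)\<rfloor>"
    define q where "q = nat \<lfloor>real n powr (1/40)\<rfloor>"
    have "real n powr (1/8) > 1" "real n powr (1/40) > 1" using elim by simp_all
    then have Q: "Q \<ge> 1" "real Q \<le> real n powr (1/8)" "real n powr (1/8) / 2 \<le> real Q"
      and q: "q \<ge> 1" "real q \<le> real n powr (1/40)" "real n powr (1/40) / 2 \<le> real q"
      using nat_floor_bounds[of "real n powr (1/8)"] nat_floor_bounds[of "real n powr (1/40)"]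
      unfolding Q_def q_def by simp_all
    show ?case
    proof (intro allI impI)
      fix y :: real and A B :: nat
      assume y: "real n powr (99/100) \<le> y" "y \<le> 2 * real n" and A: "real n powr (6271/12800) \<le> real A"
        and B: "A \<le> B" "real B \<le> 2 * real n powr (801/1600)"
      have pos: "real n powr z > 0" for z using elim by simp
      have y0: "y > 0" using y(1) pos[of "99/100"] by linarith
      have A0: "real A > 0" using A pos[of "6271/12800"] by linarith
      have "(real Q)^3 * y \<le> (real n powr (1/8))^3 * (2 * real n)"
        using Q y y0 by (intro mult_mono power_mono) auto
      also have "\<dots> \<le> (real n powr (6271/12800))^3" by (rule elim(1))
      also have "\<dots> \<le> (real A)^3" using A by (intro power_mono) auto
      finally have "\<bar>\<Sum>j=A..<B. sawtooth (y / real j)\<bar>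
          \<le> real q * (real q * y / (real A)^2 + 2) * (2 * (real B)^3 / (real Q * y) + 1)
            + 5 * real B / real q + real Q"
        using y0 A0 B Q q by (intro abs_sum_sawtooth_reciprocal_le) auto
      also have "\<dots> \<le> real n powr (1/40) * (real n powr (1/40) * (2 * real n) / (real n powr (6271/12800))^2 + 2) *
          (2 * (2 * real n powr (801/1600))^3 / (real n powr (1/8) / 2 * real n powr (99/100)) + 1)
        + 5 * (2 * real n powr (801/1600)) / (real n powr (1/40) / 2) + real n powr (1/8)"
        using y y0 A A0 B Q q pos
        by (intro add_mono mult_mono frac_le power_mono order_refl add_nonneg_nonneg mult_nonneg_nonneg
            divide_nonneg_nonneg mult_pos_pos zero_less_power zero_le_power) auto
      also have "\<dots> \<le> real n powr (6239/12800)" by (rule elim(2))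
      finally show "\<bar>\<Sum>j=A..<B. sawtooth (y / real j)\<bar> \<le> real n powr (6239/12800)" .
    qed
  qed
qed

text \<open>The summand counts the multiples of \<open>m\<close> in \<open>{n<..n+k}\<close>. Put
  \<open>m = e * j\<close> and write each floor as its argument minus sawtooth minus 1/2: the halves
  cancel, the two sawtooth sums cost \<open>2 * D\<close>, and replacing the harmonic sum by a
  logarithm costs \<open>2 * k / L \<le> 2\<close>.\<close>

lemma abs_sum_multiples_interval_le:
  fixes n k L K e :: nat and D :: real
  assumes "1 \<le> e" "2 * e \<le> L" "L \<le> K" "k \<le> L"
    and saw: "\<And>y. y \<in> {real n, real n + real k} \<Longrightarrow>
      \<bar>\<Sum>j=L div e + 1..<K div e + 1. sawtooth (y / real e / real j)\<bar> \<le> D"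
  shows "\<bar>(\<Sum>m | m \<in> {L<..K} \<and> e dvd m. real ((n + k) div m) - real (n div m))
    - real k * ln (real K / real L) / real e\<bar> \<le> 2 + 2 * D"
proof -
  let ?J = "{L div e + 1..<K div e + 1}"
  let ?s = "\<lambda>y. \<Sum>j\<in>?J. sawtooth (y / real e / real j)"
  have img: "{m. m \<in> {L<..K} \<and> e dvd m} = (*) e ` ?J"
  proof (intro set_eqI iffI)
    fix m assume "m \<in> {m. m \<in> {L<..K} \<and> e dvd m}"
    then obtain j where j: "m = e * j" "L < e * j" "e * j \<le> K" by (auto elim!: dvdE)
    then have "L div e < j" "j \<le> K div e" using assms(1)
      by (simp_all add: div_less_iff_less_mult less_eq_div_iff_mult_less_eq mult.commute)
    then show "m \<in> (*) e ` ?J" using j by auto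
  next
    fix m assume "m \<in> (*) e ` ?J"
    then obtain j where j: "m = e * j" "j \<in> ?J" by (rule imageE)
    then have "L div e < j" "j \<le> K div e" by auto
    then have "L < j * e" "j * e \<le> K" using assms(1)
      by (simp_all add: div_less_iff_less_mult less_eq_div_iff_mult_less_eq)
    then show "m \<in> {m. m \<in> {L<..K} \<and> e dvd m}" using j by (simp add: mult.commute)
  qed
  have div: "real (a div (e * j)) = real a / real e / real j - sawtooth (real a / real e / real j) - 1 / 2"
    for a j :: nat
  proof -
    have "real (a div (e * j)) = of_int \<lfloor>real a / real (e * j)\<rfloor>"
      by (simp only: floor_divide_of_nat_eq of_int_of_nat_eq)
    then show ?thesis by (simp add: sawtooth_def frac_def)
  qed
  have "(\<Sum>m | m \<in> {L<..K} \<and> e dvd m. real ((n + k) div m) - real (n div m))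
      = (\<Sum>j\<in>?J. real ((n + k) div (e * j)) - real (n div (e * j)))"
    unfolding img using assms(1) by (subst sum.reindex) (auto simp: inj_on_def)
  also have "\<dots> = (\<Sum>j\<in>?J. real k / real e * (1 / real j)
      - sawtooth ((real n + real k) / real e / real j) + sawtooth (real n / real e / real j))"
    unfolding div by (intro sum.cong refl) (simp add: add_divide_distrib)
  also have "\<dots> = real k / real e * (\<Sum>j\<in>?J. 1 / real j) - ?s (real n + real k) + ?s (real n)"
    by (simp only: sum.distrib sum_subtractf sum_distrib_left)
  finally have eq: "(\<Sum>m | m \<in> {L<..K} \<and> e dvd m. real ((n + k) div m) - real (n div m))
      = real k / real e * (\<Sum>j\<in>?J. 1 / real j) - ?s (real n + real k) + ?s (real n)" .
  have a: "2 \<le> real L / real e" "real L / real e \<le> real K / real e"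
    using assms by (simp_all add: divide_right_mono pos_le_divide_eq)
  have "\<bar>(\<Sum>j\<in>?J. 1 / real j) - ln (real K / real L)\<bar> \<le> 2 / (real L / real e)"
    using abs_sum_inverse_diff_ln_le[OF a] assms by (simp add: floor_divide_of_nat_eq)
  then have "real k / real e * \<bar>(\<Sum>j\<in>?J. 1 / real j) - ln (real K / real L)\<bar> \<le> real k / real e * (2 / (real L / real e))"
    by (intro mult_left_mono) auto
  also have "\<dots> = 2 * (real k / real L)" using assms by simp
  also have "\<dots> \<le> 2" using assms by (simp add: divide_simps)
  finally have "\<bar>real k / real e * ((\<Sum>j\<in>?J. 1 / real j) - ln (real K / real L))\<bar> \<le> 2"
    by (simp add: abs_mult)
  then have "\<bar>real k / real e * (\<Sum>j\<in>?J. 1 / real j) - real k * ln (real K / real L) / real e\<bar> \<le> 2"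
    by (simp add: right_diff_distrib)
  with saw[of "real n"] saw[of "real n + real k"] show ?thesis unfolding eq by (simp add: abs_le_iff)
qed

text \<open>The sieve runs over \<open>m\<close> in the window with weight \<open>a m\<close>, the
  number of multiples of \<open>m\<close> among \<open>n + 1, ..., n + k\<close>, so that each prime
  counted has weight at least 1.\<close>

lemma eventually_card_middle_primes_le:
  "\<forall>\<^sub>F n::nat in sequentially. let k = nat \<lceil>real n powr (6399/12800)\<rceil> in
     real (card {p. prime p \<and> k < p \<and> real p \<le> real n powr (801/1600) \<and> p dvd (\<Prod>i=1..k. n + i)})
     \<le> 3 / 10 * real k"
proof -
  have "\<forall>\<^sub>F n::nat in sequentially. 4 * real n powr (1/100) \<le> real n powr (6399/12800)"
    by real_asymp
  moreover have "\<forall>\<^sub>F n::nat in sequentially. 2 * real n powr (6399/12800) \<le> real n powr (801/1600) / 2"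
    by real_asymp
  moreover have "\<forall>\<^sub>F n::nat in sequentially. 2 * real n powr (6399/12800) \<le> real n"
    by real_asymp
  \<comment> \<open>The total sieve remainder has exponent 1/100 + 6239/12800 = 6367/12800, which is
    below 6399/12800.\<close>
  moreover have "\<forall>\<^sub>F n::nat in sequentially.
      real n powr (1/100) * (2 + 2 * real n powr (6239/12800)) \<le> real n powr (6399/12800) / 100"
    by real_asymp
  moreover have "\<forall>\<^sub>F n::nat in sequentially. n \<ge> 2" by (rule eventually_ge_at_top)
  ultimately show ?thesis using eventually_sum_sawtooth_le
  proof eventually_elim
    case (elim n)
    define k where "k = nat \<lceil>real n powr (6399/12800)\<rceil>"
    define K where "K = nat \<lfloor>real n powr (801/1600)\<rfloor>"
    define R where "R = nat \<lfloor>real n powr (1/200)\<rfloor>"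
    define a where "a m = real ((n + k) div m) - real (n div m)" for m
    have gt1: "real n powr z > 1" if "z > 0" for z using elim that by simp
    have k: "real n powr (6399/12800) \<le> real k" "real k \<le> 2 * real n powr (6399/12800)" "k \<ge> 1"
      using gt1[of "6399/12800"] unfolding k_def by linarith+
    have K: "K \<ge> 1" "real K \<le> real n powr (801/1600)" "real n powr (801/1600) / 2 \<le> real K"
      using nat_floor_bounds[of "real n powr (801/1600)"] gt1[of "801/1600"] unfolding K_def by simp_all
    have R: "R \<ge> 1" "real R \<le> real n powr (1/200)" "real n powr (1/200) \<le> real R + 1"
      using nat_floor_bounds[of "real n powr (1/200)"] gt1[of "1/200"] unfolding R_def by simp_all
    have "real k \<le> real K" using k K elim(2) by linarith
    then have kK: "k \<le> K" by simp
    have "real k \<le> real n" using k elim(3) by linarith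
    then have kn: "k \<le> n" by simp
    have R2: "real (R^2) \<le> real n powr (1/100)"
    proof -
      have "real (R^2) \<le> (real n powr (1/200))^2" using R by (simp add: power_mono)
      also have "\<dots> = real n powr (1/100)" using elim by (simp add: powr_power)
      finally show ?thesis .
    qed
    have "real R \<le> real n powr (1/100)"
    proof -
      have "R \<le> R^2" using R(1) by (simp add: power2_eq_square)
      then have "real R \<le> real (R^2)" by (rule of_nat_mono)
      with R2 show ?thesis by linarith
    qed
    then have "real R < real k" using k elim(1) gt1[of "1/100"] by linarith
    then have Rk: "R < k" by simp
    define X where "X = real k * ln (real K / real k)"
    have "(\<Sum>p | p \<in> {k<..K} \<and> prime p \<and> p > R. a p)
        \<le> X / squarefree_harm R + real (R^2) * (2 + 2 * real n powr (6239/12800))"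
    proof (intro selberg_sieve R)
      show "a m \<ge> 0" for m by (simp add: a_def div_le_mono)
      show "X \<ge> 0" using kK k by (simp add: X_def)
      fix e :: nat assume e: "1 \<le> e" "e \<le> R^2"
      have eR: "real e \<le> real n powr (1/100)" using e(2) R2 by (meson of_nat_mono order_trans)
      show "\<bar>(\<Sum>m | m \<in> {k<..K} \<and> e dvd m. a m) - X / real e\<bar> \<le> 2 + 2 * real n powr (6239/12800)"
        unfolding a_def X_def
      proof (intro abs_sum_multiples_interval_le e(1) kK order_refl)
        have "2 * real e \<le> real k" using eR elim(1) k by linarith
        then show "2 * e \<le> k" by linarith
        fix y assume y: "y \<in> {real n, real n + real k}"
        then have y': "real n \<le> y" "y \<le> 2 * real n" using kn by auto
        \<comment> \<open>Dividing by a modulus \<open>e \<le> n powr (1/100)\<close> lowers the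
          exponents of \<open>y\<close> and of the left endpoint by at most 1/100, which stays
          within the ranges of \<open>eventually_sum_sawtooth_le\<close>.\<close>
        have "real n powr (99/100) = real n / real n powr (1/100)"
          using powr_diff[of "real n" 1 "1/100"] elim by simp
        also have "\<dots> \<le> y / real e" using y' e eR by (intro frac_le) auto
        finally have y1: "real n powr (99/100) \<le> y / real e" .
        have "y / real e \<le> y / 1" using y' e by (intro divide_left_mono) auto
        then have y2: "y / real e \<le> 2 * real n" using y' by simp
        have "real n powr (6271/12800) = real n powr (6399/12800) / real n powr (1/100)"
          using powr_diff[of "real n" "6399/12800" "1/100"] by simp
        also have "\<dots> \<le> real k / real e" using k e eR by (intro frac_le) auto
        also have "\<dots> \<le> real (k div e + 1)"
          using floor_divide_of_nat_eq[of k e, where ?'a = real] by linarith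
        finally have A: "real n powr (6271/12800) \<le> real (k div e + 1)" .
        have "real (K div e + 1) \<le> real K + 1" using div_le_dividend[of K e] by simp
        then have B: "real (K div e + 1) \<le> 2 * real n powr (801/1600)"
          using K gt1[of "801/1600"] by linarith
        show "\<bar>\<Sum>j=k div e + 1..<K div e + 1. sawtooth (y / real e / real j)\<bar> \<le> real n powr (6239/12800)"
          by (rule elim(6)[rule_format, OF y1 y2 A _ B]) (simp add: kK div_le_mono)
      qed
    qed auto
    \<comment> \<open>The window has logarithmic length 801/1600 - 6399/12800 = 9/12800 in units of
      \<open>ln n\<close>, while the normaliser is at least \<open>ln n / 400\<close>; the quotient
      is 9/32. The remainder below adds 1/100, giving less than 3/10.\<close>
    also have "X / squarefree_harm R \<le> 9 / 32 * real k"
    proof -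
      have "ln (real n) / 200 = ln (real n powr (1/200))" by (simp add: ln_powr)
      also have "\<dots> \<le> ln (real R + 1)" using R(3) gt1[of "1/200"] by (intro ln_mono) linarith+
      finally have S: "ln (real n) / 400 \<le> squarefree_harm R" using squarefree_harm_ge[of R] by linarith
      have "ln (real K) \<le> ln (real n powr (801/1600))" using K by (intro ln_mono) auto
      moreover have "ln (real n powr (6399/12800)) \<le> ln (real k)"
        using k gt1[of "6399/12800"] by (intro ln_mono) linarith+
      moreover have "ln (real K / real k) = ln (real K) - ln (real k)" using K k by (simp add: ln_div)
      ultimately have "ln (real K / real k) \<le> 9 / 12800 * ln (real n)" by (simp add: ln_powr)
      then have "X \<le> real k * (9 / 12800 * ln (real n))" unfolding X_def by (intro mult_left_mono) auto
      also have "\<dots> = 9 / 32 * real k * (ln (real n) / 400)" by simp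
      also have "\<dots> \<le> 9 / 32 * real k * squarefree_harm R" using S by (intro mult_left_mono) auto
      finally show ?thesis using squarefree_harm_pos[OF R(1)] by (simp add: pos_divide_le_eq)
    qed
    also have "real (R^2) * (2 + 2 * real n powr (6239/12800))
        \<le> real n powr (1/100) * (2 + 2 * real n powr (6239/12800))"
      using R2 by (intro mult_right_mono) auto
    also have "\<dots> \<le> real k / 100" using elim(4) k by linarith
    finally have sum_le: "(\<Sum>p | p \<in> {k<..K} \<and> prime p \<and> p > R. a p) \<le> 3 / 10 * real k" by simp
    let ?P = "{p. prime p \<and> k < p \<and> real p \<le> real n powr (801/1600) \<and> p dvd (\<Prod>i=1..k. n + i)}"
    have sub: "?P \<subseteq> {p. p \<in> {k<..K} \<and> prime p \<and> p > R}"
      using Rk by (auto simp: K_def le_nat_iff le_floor_iff)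
    have "real (card ?P) = (\<Sum>p\<in>?P. 1)" by simp
    \<comment> \<open>If \<open>n + i = p * c\<close> with \<open>1 \<le> i \<le> k\<close>, then
      \<open>c\<close> exceeds \<open>n div p\<close> but not \<open>(n + k) div p\<close>.\<close>
    also have "\<dots> \<le> (\<Sum>p\<in>?P. a p)"
    proof (intro sum_mono)
      fix p assume p: "p \<in> ?P"
      then obtain i where i: "i \<in> {1..k}" "p dvd n + i"
        by (auto simp: prime_dvd_prod_iff)
      then obtain c where c: "n + i = p * c" by blast
      have p0: "p > 0" using p by (auto dest: prime_gt_0_nat)
      have "n < c * p" using c i by (simp add: mult.commute)
      then have "n div p < c" using p0 by (simp add: div_less_iff_less_mult)
      moreover have "c \<le> (n + k) div p" using c i p0
        by (simp add: less_eq_div_iff_mult_less_eq mult.commute)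
      ultimately show "1 \<le> a p" unfolding a_def by linarith
    qed
    also have "\<dots> \<le> (\<Sum>p | p \<in> {k<..K} \<and> prime p \<and> p > R. a p)"
      using sub by (intro sum_mono2) (auto simp: a_def div_le_mono)
    finally show ?case using sum_le unfolding k_def Let_def by linarith
  qed
qed

section \<open>Comparing the logarithm of the product with the sizes of its prime factors\<close>

lemma filterlim_nat_ceiling_powr:
  "filterlim (\<lambda>n::nat. nat \<lceil>real n powr (6399/12800)\<rceil>) sequentially sequentially"
  unfolding filterlim_at_top
proof
  fix Z
  have "\<forall>\<^sub>F n::nat in sequentially. real Z \<le> real n powr (6399/12800)" by real_asymp
  then show "\<forall>\<^sub>F n in sequentially. Z \<le> nat \<lceil>real n powr (6399/12800)\<rceil>"
    by eventually_elim linarith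
qed

lemma eventually_omega_prod_less:
  "\<forall>\<^sub>F n::nat in sequentially. let k = nat \<lceil>real n powr (6399/12800)\<rceil> in omega (\<Prod>i=1..k. n + i) < k"
proof -
  have "\<forall>\<^sub>F n::nat in sequentially. ln (real n) > 7000" by real_asymp
  moreover have "\<forall>\<^sub>F n::nat in sequentially. 2 * real n powr (6399/12800) \<le> real n" by real_asymp
  moreover have "\<forall>\<^sub>F n in sequentially. real (card {p. prime p \<and> p \<le> nat \<lceil>real n powr (6399/12800)\<rceil>})
      \<le> 1 / 12800 * real (nat \<lceil>real n powr (6399/12800)\<rceil>)"
    using eventually_compose_filterlim[OF eventually_card_primes_le filterlim_nat_ceiling_powr, of "1/12800"]
    by simp
  moreover have "\<forall>\<^sub>F n::nat in sequentially. n \<ge> 2" by (rule eventually_ge_at_top)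
  ultimately show ?thesis using eventually_card_middle_primes_le
  proof eventually_elim
    case (elim n)
    define k where "k = nat \<lceil>real n powr (6399/12800)\<rceil>"
    define M where "M = (\<Prod>i=1..k. n + i)"
    define L where "L = ln (real n)"
    define P\<^sub>1 where "P\<^sub>1 = {p. prime p \<and> p \<le> k \<and> p dvd M}"
    define P\<^sub>2 where "P\<^sub>2 = {p. prime p \<and> k < p \<and> real p \<le> real n powr (801/1600) \<and> p dvd M}"
    define P\<^sub>3 where "P\<^sub>3 = {p. prime p \<and> k < p \<and> real p > real n powr (801/1600) \<and> p dvd M}"
    have gt1: "real n powr z > 1" if "z > 0" for z using elim that by simp
    have k: "real n powr (6399/12800) \<le> real k" "real k \<le> 2 * real n powr (6399/12800)" "k \<ge> 1"
      using gt1[of "6399/12800"] unfolding k_def by linarith+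
    have kn: "real k \<le> real n" using k elim(2) by linarith
    have M0: "M > 0" using elim by (auto simp: M_def intro!: prod_pos)
    have fin: "finite {p. p dvd M}" using M0 by simp
    have fin123: "finite P\<^sub>1" "finite P\<^sub>2" "finite P\<^sub>3"
      unfolding P\<^sub>1_def P\<^sub>2_def P\<^sub>3_def by (auto intro: finite_subset[OF _ fin])
    have c1: "real (card P\<^sub>1) \<le> real k / 12800"
    proof -
      have "card P\<^sub>1 \<le> card {p. prime p \<and> p \<le> k}"
        unfolding P\<^sub>1_def by (intro card_mono) (auto intro: finite_subset[of _ "{..k}"])
      with elim(3) show ?thesis unfolding k_def by linarith
    qed
    have c2: "real (card P\<^sub>2) \<le> 3 / 10 * real k"
      using elim(5) unfolding P\<^sub>2_def M_def k_def Let_def by simp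
    \<comment> \<open>The primes in \<open>P\<^sub>2\<close> and \<open>P\<^sub>3\<close> exceed
      \<open>k\<close>, so their product is coprime to \<open>fact k\<close>. Dividing out the
      factorial lowers the logarithmic budget from \<open>k * ln n\<close> to about
      \<open>k * (ln n - ln k)\<close>.\<close>
    have "fact k * (\<Prod>p\<in>P\<^sub>2 \<union> P\<^sub>3. p) dvd M"
    proof (intro divides_mult)
      show "fact k dvd M" unfolding M_def by (rule fact_dvd_prod_consecutive)
      show "(\<Prod>p\<in>P\<^sub>2 \<union> P\<^sub>3. p) dvd M"
        using fin123 by (intro prod_primes_dvd) (auto simp: P\<^sub>2_def P\<^sub>3_def)
      show "coprime (fact k) (\<Prod>p\<in>P\<^sub>2 \<union> P\<^sub>3. p)"
        by (intro prod_coprime_right)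
          (auto simp: P\<^sub>2_def P\<^sub>3_def coprime_commute prime_dvd_fact_iff intro!: prime_imp_coprime)
    qed
    then have "fact k * (\<Prod>p\<in>P\<^sub>2 \<union> P\<^sub>3. p) \<le> M" using M0 by (rule dvd_imp_le)
    then have "real (fact k * (\<Prod>p\<in>P\<^sub>2 \<union> P\<^sub>3. p)) \<le> real M" by (rule of_nat_mono)
    then have le: "fact k * ((\<Prod>p\<in>P\<^sub>2. real p) * (\<Prod>p\<in>P\<^sub>3. real p)) \<le> real M"
      using fin123 by (subst (asm) prod.union_disjoint) (auto simp: P\<^sub>2_def P\<^sub>3_def)
    have pos: "(\<Prod>p\<in>P\<^sub>2. real p) > 0" "(\<Prod>p\<in>P\<^sub>3. real p) > 0"
      by (auto simp: P\<^sub>2_def P\<^sub>3_def prime_gt_0_nat intro!: prod_pos)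
    have "ln (fact k) + (ln (\<Prod>p\<in>P\<^sub>2. real p) + ln (\<Prod>p\<in>P\<^sub>3. real p))
        = ln (fact k * ((\<Prod>p\<in>P\<^sub>2. real p) * (\<Prod>p\<in>P\<^sub>3. real p)))"
      using pos by (simp add: ln_mult)
    also have "\<dots> \<le> ln (real M)" using le pos by (intro ln_mono) auto
    \<comment> \<open>Each factor is at most \<open>2 * n\<close> because \<open>k \<le> n\<close>,
      and \<open>ln 2 \<le> 1\<close>.\<close>
    also have "\<dots> \<le> real k * (L + 1)"
    proof -
      have "real M = (\<Prod>i=1..k. real n + real i)" by (simp add: M_def)
      also have "\<dots> \<le> (\<Prod>i=1..k. 2 * real n)" using kn by (intro prod_mono) auto
      finally have "real M \<le> (2 * real n) ^ k" by simp
      then have "ln (real M) \<le> ln ((2 * real n) ^ k)" using M0 by (intro ln_mono) auto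
      also have "\<dots> = real k * (ln 2 + L)" using elim by (simp add: ln_realpow ln_mult L_def distrib_left)
      also have "\<dots> \<le> real k * (1 + L)" using ln_le_minus_one[of 2] by (intro mult_left_mono) auto
      finally show ?thesis by (simp add: add.commute)
    qed
    finally have main: "ln (fact k) + (ln (\<Prod>p\<in>P\<^sub>2. real p) + ln (\<Prod>p\<in>P\<^sub>3. real p)) \<le> real k * (L + 1)" .
    have lnk: "6399 / 12800 * L \<le> ln (real k)"
    proof -
      have "ln (real n powr (6399/12800)) \<le> ln (real k)"
        using k gt1[of "6399/12800"] by (intro ln_mono) linarith+
      then show ?thesis by (simp add: ln_powr L_def)
    qed
    have f: "real k * (6399 / 12800 * L) - real k \<le> ln (fact k)"
      using ln_fact_ge[of k] mult_left_mono[OF lnk, of "real k"] by simp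
    have l2: "real (card P\<^sub>2) * (6399 / 12800 * L) \<le> ln (\<Prod>p\<in>P\<^sub>2. real p)"
    proof -
      have "real (card P\<^sub>2) * (6399 / 12800 * L) = (\<Sum>p\<in>P\<^sub>2. 6399 / 12800 * L)" by simp
      also have "\<dots> \<le> (\<Sum>p\<in>P\<^sub>2. ln (real p))"
      proof (intro sum_mono)
        fix p assume "p \<in> P\<^sub>2"
        then have "ln (real k) \<le> ln (real p)" using k by (intro ln_mono) (auto simp: P\<^sub>2_def)
        with lnk show "6399 / 12800 * L \<le> ln (real p)" by linarith
      qed
      also have "\<dots> = ln (\<Prod>p\<in>P\<^sub>2. real p)"
        using fin123(2) by (rule ln_prod[symmetric]) (auto simp: P\<^sub>2_def prime_gt_0_nat)
      finally show ?thesis .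
    qed
    have l3: "real (card P\<^sub>3) * (801 / 1600 * L) \<le> ln (\<Prod>p\<in>P\<^sub>3. real p)"
    proof -
      have "real (card P\<^sub>3) * (801 / 1600 * L) = (\<Sum>p\<in>P\<^sub>3. ln (real n powr (801 / 1600)))"
        by (simp add: ln_powr L_def)
      also have "\<dots> \<le> (\<Sum>p\<in>P\<^sub>3. ln (real p))"
        using elim(4) by (intro sum_mono ln_mono) (auto simp: P\<^sub>3_def)
      also have "\<dots> = ln (\<Prod>p\<in>P\<^sub>3. real p)"
        using fin123(3) by (rule ln_prod[symmetric]) (auto simp: P\<^sub>3_def prime_gt_0_nat)
      finally show ?thesis .
    qed
    have "omega M < k"
    proof (rule ccontr)
      assume "\<not> omega M < k"
      moreover have "prime_factors M = P\<^sub>1 \<union> P\<^sub>2 \<union> P\<^sub>3"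
        using M0 by (auto simp: P\<^sub>1_def P\<^sub>2_def P\<^sub>3_def prime_factors_dvd)
      then have "omega M \<le> card P\<^sub>1 + card P\<^sub>2 + card P\<^sub>3"
        using card_Un_le[of "P\<^sub>1 \<union> P\<^sub>2" P\<^sub>3] card_Un_le[of P\<^sub>1 P\<^sub>2] by (simp add: omega_def)
      ultimately have "real k \<le> real (card P\<^sub>1) + real (card P\<^sub>2) + real (card P\<^sub>3)" by linarith
      with c1 have c3: "real k - real k / 12800 - real (card P\<^sub>2) \<le> real (card P\<^sub>3)" by linarith
      have L: "L > 7000" using elim(1) by (simp add: L_def)
      have "(real k - real k / 12800 - real (card P\<^sub>2)) * (801 / 1600 * L) \<le> real (card P\<^sub>3) * (801 / 1600 * L)"
        using c3 L by (intro mult_right_mono) auto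
      with main f l2 l3 have "(real k - real k / 12800 - real (card P\<^sub>2)) * (801 / 1600 * L)
          + real (card P\<^sub>2) * (6399 / 12800 * L) + (real k * (6399 / 12800 * L) - real k) \<le> real k * (L + 1)"
        by linarith
      \<comment> \<open>Clearing denominators means multiplying by 12800 * 1600. The bound 3/10 for
        \<open>P\<^sub>2\<close> contributes 4320 to the right side, leaving
        \<open>6079 * L \<le> 40960000\<close>, which contradicts \<open>L > 7000\<close>.\<close>
      then have "10399 * (real k * L) \<le> 14400 * (real (card P\<^sub>2) * L) + 40960000 * real k"
        by (simp add: algebra_simps)
      moreover have "real (card P\<^sub>2) * L \<le> 3 / 10 * real k * L" using c2 L by (intro mult_right_mono) auto
      moreover have "real k * 7000 \<le> real k * L" using L by (intro mult_left_mono) auto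
      moreover have "real k > 0" using k by simp
      ultimately show False by simp
    qed
    then show ?case by (simp add: M_def k_def Let_def)
  qed
qed

theorem theorem1p3:
  shows "\<exists>\<gamma>::real. 0 < \<gamma> \<and> \<gamma> < 1/2 \<and>
    (\<forall>\<^sub>F n in sequentially. g n \<le> g1 n \<and> real (g1 n) < real n powr \<gamma>)"
proof (intro exI conjI)
  have "\<forall>\<^sub>F n::nat in sequentially. n \<ge> 2" by (rule eventually_ge_at_top)
  with eventually_omega_prod_less
  show "\<forall>\<^sub>F n in sequentially. g n \<le> g1 n \<and> real (g1 n) < real n powr (6399/12800)"
  proof eventually_elim
    case (elim n)
    define k where "k = nat \<lceil>real n powr (6399/12800)\<rceil>"
    define G where "G m \<longleftrightarrow> m \<ge> 1 \<and> (\<forall>l\<in>{1..m}. omega (\<Prod>i=1..l. n + i) \<ge> l)" for m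
    have "real n powr (6399/12800) > 0" using elim by simp
    then have "k \<ge> 1" unfolding k_def by linarith
    \<comment> \<open>\<open>G m\<close> constrains every \<open>l\<close> up to \<open>m\<close>,
      so the single failure at \<open>k\<close> excludes all \<open>m \<ge> k\<close>. This bound
      also ensures that the \<open>GREATEST\<close> values are attained.\<close>
    have less_k: "m < k" if "G m" for m
    proof (rule ccontr)
      assume "\<not> m < k"
      with that \<open>k \<ge> 1\<close> have "omega (\<Prod>i=1..k. n + i) \<ge> k" by (auto simp: G_def)
      with elim(1) show False unfolding k_def Let_def by (meson not_le)
    qed
    \<comment> \<open>The primes \<open>P 1, ..., P l\<close> are distinct and all divide the
      product of the first \<open>l\<close> factors.\<close>
    have rep: "G m" if "m \<ge> 1" "has_prime_rep n m" for m
    proof -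
      obtain P where P: "inj_on P {1..m}" "\<And>j. j \<in> {1..m} \<Longrightarrow> prime (P j) \<and> P j dvd n + j"
        using \<open>has_prime_rep n m\<close> unfolding has_prime_rep_def by blast
      have "l \<le> omega (\<Prod>i=1..l. n + i)" if l: "l \<in> {1..m}" for l
      proof -
        have sub: "P ` {1..l} \<subseteq> prime_factors (\<Prod>i=1..l. n + i)"
        proof
          fix p assume "p \<in> P ` {1..l}"
          then obtain j where j: "p = P j" "j \<in> {1..l}" by blast
          then have "n + j dvd (\<Prod>i=1..l. n + i)" by (intro dvd_prodI) auto
          moreover have "prime p" "p dvd n + j" using P(2)[of j] j l by auto
          ultimately show "p \<in> prime_factors (\<Prod>i=1..l. n + i)"
            using elim by (auto simp: prime_factors_dvd dest: dvd_trans)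
        qed
        have "inj_on P {1..l}" using P(1) by (rule inj_on_subset) (use l in auto)
        then have "l = card (P ` {1..l})" by (simp add: card_image)
        also have "\<dots> \<le> omega (\<Prod>i=1..l. n + i)" unfolding omega_def by (intro card_mono sub) simp
        finally show ?thesis .
      qed
      with that(1) show ?thesis by (simp add: G_def)
    qed
    \<comment> \<open>\<open>GREATEST\<close> attains its predicate only if some number satisfies
      it; \<open>m = 1\<close> with any prime factor of \<open>n + 1\<close> is that
      witness.\<close>
    have rep1: "1 \<le> (1::nat) \<and> has_prime_rep n 1"
    proof -
      obtain p where "prime p" "p dvd n + 1" using prime_factor_nat[of "n + 1"] elim by auto
      then show ?thesis by (auto simp: has_prime_rep_def intro!: exI[of _ "\<lambda>_. p"])
    qed
    have "1 \<le> g n \<and> has_prime_rep n (g n)"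
      unfolding g_def using rep1 by (rule GreatestI_nat[where b = k]) (use rep less_k in \<open>auto intro: less_imp_le\<close>)
    then have Gg: "G (g n)" by (intro rep) auto
    have g1: "g1 n = (GREATEST m. G m)" by (simp add: g1_def G_def)
    have "g n \<le> g1 n" unfolding g1
      by (rule Greatest_le_nat[where P = G and b = k, OF Gg]) (use less_k in \<open>auto intro: less_imp_le\<close>)
    moreover have "G (g1 n)" unfolding g1
      by (rule GreatestI_nat[where P = G and b = k, OF Gg]) (use less_k in \<open>auto intro: less_imp_le\<close>)
    then have "g1 n < k" by (rule less_k)
    \<comment> \<open>As \<open>k\<close> is a ceiling, \<open>k - 1\<close> lies strictly below the
      power, so \<open>g1 n < k\<close> yields the strict inequality.\<close>
    then have "real (g1 n) < real n powr (6399/12800)" unfolding k_def by linarith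
    ultimately show ?case ..
  qed
qed auto

end
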